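(* Let $\mathcal{M}_k=\{p_\theta:\theta\in\Theta_k\}$, $k\in\mathbb{Z}^+$, be parametric models with priors $w_k$ on $\Theta_k$, let $\bar p_1,\bar p_2,\ldots$ be the corresponding Bayesian prediction strategies, and let $\pi$ be the prior (a probability mass function on $\mathbb{S}$) of the switch distribution defined relative to $\bar p_1,\bar p_2,\ldots$. Suppose that $\pi$ is positive everywhere on $\{\mathbf{s}\in\mathbb{S}\mid m(\mathbf{s})=1\}$ and that there is a positive constant $c$ such that $c\cdot\pi(\mathbf{s})\ge\pi(E_{\mathbf{s}})$ for every $\mathbf{s}\in\mathbb{S}$. Suppose further that $\bar P_k(X_{n+1}^\infty\mid x^n)$ and $\bar P_{k'}(X_{n+1}^\infty\mid x^n)$ are mutually singular for all $k,k'\in\mathbb{Z}^+$ with $k\neq k'$, all $n$ and all $x^n\in\mathcal{X}^n$. Then, for all $k^*\in\mathbb{Z}^+$ and for all $\theta^*\in\Theta_{k^*}$ except for a subset of $\Theta_{k^*}$ of $w_{k^*}$-measure $0$, the posterior distribution on $K_{n+1}$ satisfies $$\pi(K_{n+1}=k^*\mid X^n)\xrightarrow[n\to\infty]{}1\qquad\text{with }P_{\theta^*}\text{-probability }1.$$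
   Context: $X^\infty=(X_1,X_2,\ldots)$ takes values in $\mathcal{X}^\infty$ with $\mathcal{X}\subseteq\mathbb{R}^d$; $x^n=(x_1,\ldots,x_n)$, $X_{n+1}^\infty=(X_{n+1},X_{n+2},\ldots)$. Densities are relative to Lebesgue measure ($\mathcal X$ continuous) or counting measure ($\mathcal X$ countable). $\mathbb{N}=\{0,1,2,\dots\}$, $\mathbb{Z}^+=\{1,2,\dots\}$. Prediction strategy: a prediction strategy $p$ assigns to each $n\in\mathbb N$ and $x^n\in\mathcal X^n$ a density $p(X_{n+1}\mid x^n)$ for the next outcome, with corresponding distribution $P(X_{n+1}\mid x^n)$, such that for each fixed measurable $A$ the probability $P(A\mid x^n)$ is a measurable function of $x^n$. It defines joint densities $p(x^n)=\prod_{i=1}^n p(x_i\mid x^{i-1})$, a distribution $P$ on $\mathcal X^\infty$, and conditional distributions $P(X_{n+1}^\infty\mid x^n)$ on future sequences. Parametric model: a set $\mathcal M_k=\{p_\theta:\theta\in\Theta_k\}$ of prediction strategies with $\Theta_k\subseteq\mathbb R^{d_k}$; $P_\theta$ is the distribution of $X^\infty$ given by $p_\theta$. The Bayesian prediction strategy $\bar p_k$ has joint density $\bar p_k(x^n)=\int_{\Theta_k}p_\theta(x^n)w_k(\theta)\,d\theta$ and conditionals $\bar p_k(x_{n+1}\mid x^n)=\bar p_k(x^{n+1})/\bar p_k(x^n)$; $\bar P_k$ is the corresponding distribution. Switch distribution: $\mathbb{S}=\{((t_1,k_1),\ldots,(t_m,k_m))\in(\mathbb N\times\mathbb Z^+)^m\mid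 m\in\mathbb Z^+,\ 0=t_1<\cdots<t_m\}$. For $\mathbf s\in\mathbb S$ its components are written $m(\mathbf s),t_i(\mathbf s),k_i(\mathbf s)$. For $n\ge0$, $K_{n+1}(\mathbf s)=k_i(\mathbf s)$ for the unique $i$ such that $t_i(\mathbf s)\le n$ and either $i=m(\mathbf s)$ or $t_{i+1}(\mathbf s)>n$. Define $q_{\mathbf s}(X_{n+1}\mid x^n)=\bar p_{K_{n+1}(\mathbf s)}(X_{n+1}\mid x^n)$ and $q_{\mathbf s}(x^n)=\prod_{i=1}^n q_{\mathbf s}(x_i\mid x^{i-1})$. The switch distribution with prior $\pi$ has marginal density $p_{\rm sw}(x^n)=\sum_{\mathbf s\in\mathbb S}q_{\mathbf s}(x^n)\pi(\mathbf s)$, and $$\pi(K_{n+1}=k\mid x^n)=\frac{\sum_{\{\mathbf s:K_{n+1}(\mathbf s)=k\}}q_{\mathbf s}(x^n)\pi(\mathbf s)}{p_{\rm sw}(x^n)}$$ whenever $p_{\rm sw}(x^n)>0$. $E_{\mathbf s}=\{\mathbf s'\in\mathbb S\mid m(\mathbf s')>m(\mathbf s),\ (t_i(\mathbf s'),k_i(\mathbf s'))=(t_i(\mathbf s),k_i(\mathbf s))\text{ for }i=1,\ldots,m(\mathbf s)\}$ is the set of proper extensions of $\mathbf s$ to more switch-points. *)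

theory Defs
  imports "HOL-Probability.Probability"
begin

section \<open>Outcome spaces and prediction strategies\<close>

text \<open>
  Densities are relative to \<open>N\<close>: either Lebesgue measure on a Borel set \<open>X\<close> of a Euclidean space
  or counting measure on a countable \<open>X\<close>.
\<close>

definition base_measure :: "'a::euclidean_space set \<Rightarrow> 'a measure \<Rightarrow> bool" where
  "base_measure X N \<longleftrightarrow>
     (X \<in> sets borel \<and> N = restrict_space lborel X) \<or> (countable X \<and> N = count_space X)"

text \<open>
  Outcomes are numbered from 0, so the outcome \<open>X\<^sub>i\<^sub>+\<^sub>1\<close> is coordinate \<open>i\<close>, and a history
  \<open>x\<^sup>n = (x\<^sub>1, \<dots>, x\<^sub>n)\<close> is an element of \<open>space (\<Pi>\<^sub>M i\<in>{0..<n}. N)\<close>. The value \<open>p n x y\<close> is the density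
  of the next outcome \<open>y\<close> after the history \<open>x\<close> of length \<open>n\<close>.
\<close>

type_synonym 'a strategy = "nat \<Rightarrow> (nat \<Rightarrow> 'a) \<Rightarrow> 'a \<Rightarrow> ennreal"

definition next_dist :: "'a measure \<Rightarrow> 'a strategy \<Rightarrow> nat \<Rightarrow> (nat \<Rightarrow> 'a) \<Rightarrow> 'a measure" where
  "next_dist N p n x = density N (p n x)"

text \<open>
  The density is required to be measurable in history and outcome together; this is what makes the
  joint densities measurable. It implies that \<open>P(A | x\<^sup>n)\<close> is measurable in \<open>x\<^sup>n\<close>, see
  \<open>pred_strategy_Ionescu_Tulcea\<close> below.
\<close>

definition pred_strategy :: "'a measure \<Rightarrow> 'a strategy \<Rightarrow> bool" where
  "pred_strategy N p \<longleftrightarrow> (\<forall>n.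
     (\<lambda>(x, y). p n x y) \<in> borel_measurable ((\<Pi>\<^sub>M i\<in>{0..<n}. N) \<Otimes>\<^sub>M N) \<and>
     (\<forall>x \<in> space (\<Pi>\<^sub>M i\<in>{0..<n}. N). prob_space (next_dist N p n x)))"

definition joint_density :: "'a strategy \<Rightarrow> nat \<Rightarrow> (nat \<Rightarrow> 'a) \<Rightarrow> ennreal" where
  "joint_density p n x = (\<Prod>i<n. p i (restrict x {0..<i}) (x i))"

definition seq_dist :: "'a measure \<Rightarrow> 'a strategy \<Rightarrow> (nat \<Rightarrow> 'a) measure" where
  "seq_dist N p =
     projective_family.lim UNIV (Ionescu_Tulcea.CI (next_dist N p) (\<lambda>_. N)) (\<lambda>_. N)"

definition future_strategy :: "'a strategy \<Rightarrow> nat \<Rightarrow> (nat \<Rightarrow> 'a) \<Rightarrow> 'a strategy" where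
  "future_strategy p n x = (\<lambda>i z. p (n + i) (restrict (comb_seq n x z) {0..<n + i}))"

text \<open>The conditional distribution \<open>P(X\<^sub>n\<^sub>+\<^sub>1\<^sup>\<infinity> | x\<^sup>n)\<close>; future outcomes are renumbered from 0.\<close>

definition future_dist :: "'a measure \<Rightarrow> 'a strategy \<Rightarrow> nat \<Rightarrow> (nat \<Rightarrow> 'a) \<Rightarrow> (nat \<Rightarrow> 'a) measure" where
  "future_dist N p n x = seq_dist N (future_strategy p n x)"

definition mutually_singular :: "'b measure \<Rightarrow> 'b measure \<Rightarrow> bool" where
  "mutually_singular P Q \<longleftrightarrow> sets P = sets Q \<and>
     (\<exists>A \<in> sets P. emeasure P A = 0 \<and> emeasure Q (space Q - A) = 0)"

lemma base_measure_sigma_finite: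
  assumes "base_measure X N"
  shows "sigma_finite_measure N"
  using assms unfolding base_measure_def
proof
  assume *: "X \<in> sets borel \<and> N = restrict_space lborel X"
  have "X \<in> sets lborel"
    using * by simp
  from sigma_finite_measure_restrict_space[OF sigma_finite_lborel this] show ?thesis
    using * by simp
next
  assume "countable X \<and> N = count_space X"
  then show ?thesis
    by (simp add: sigma_finite_measure_count_space_countable)
qed

lemma pred_strategy_Ionescu_Tulcea:
  assumes "sigma_finite_measure N" and p: "pred_strategy N p"
  shows "Ionescu_Tulcea (next_dist N p) (\<lambda>_. N)"
proof (rule Ionescu_Tulcea.intro)
  show ps: "prob_space (next_dist N p n x)" if "x \<in> space (\<Pi>\<^sub>M i\<in>{0..<n}. N)" for n x
    using p that by (auto simp: pred_strategy_def)
  interpret sigma_finite_measure N by fact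
  show "next_dist N p n \<in> measurable (\<Pi>\<^sub>M i\<in>{0..<n}. N) (subprob_algebra N)" for n
  proof (rule measurable_subprob_algebra)
    have m[measurable]: "(\<lambda>(x, y). p n x y) \<in> borel_measurable ((\<Pi>\<^sub>M i\<in>{0..<n}. N) \<Otimes>\<^sub>M N)"
      using p by (auto simp: pred_strategy_def)
    show "subprob_space (next_dist N p n x)" if "x \<in> space (\<Pi>\<^sub>M i\<in>{0..<n}. N)" for x
      using ps[OF that] by (rule prob_space_imp_subprob_space)
    show "sets (next_dist N p n x) = sets N" for x
      by (simp add: next_dist_def)
    fix A assume A[measurable]: "A \<in> sets N"
    have "(\<lambda>x. \<integral>\<^sup>+y. p n x y * indicator A y \<partial>N) \<in> borel_measurable (\<Pi>\<^sub>M i\<in>{0..<n}. N)"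
      by measurable
    moreover have "emeasure (next_dist N p n x) A = (\<integral>\<^sup>+y. p n x y * indicator A y \<partial>N)"
      if x: "x \<in> space (\<Pi>\<^sub>M i\<in>{0..<n}. N)" for x
    proof -
      have "p n x \<in> borel_measurable N"
        using measurable_compose[OF measurable_Pair1'[OF x] m] by simp
      then show ?thesis
        by (simp add: next_dist_def emeasure_density)
    qed
    ultimately show
      "(\<lambda>x. emeasure (next_dist N p n x) A) \<in> borel_measurable (\<Pi>\<^sub>M i\<in>{0..<n}. N)"
      by (simp cong: measurable_cong)
  qed
qed

section \<open>Parametric models and Bayesian prediction strategies\<close>

text \<open>
  Lebesgue measure on \<open>\<real>\<^sup>m\<close>. The dimension of the parameter space varies with the model, so vectors
  are functions on \<open>{..<m}\<close>.
\<close>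

definition lebesgue_pow :: "nat \<Rightarrow> (nat \<Rightarrow> real) measure" where
  "lebesgue_pow m = (\<Pi>\<^sub>M i\<in>{..<m}. lborel)"

abbreviation param_space :: "nat \<Rightarrow> (nat \<Rightarrow> real) set \<Rightarrow> (nat \<Rightarrow> real) measure" where
  "param_space m \<Theta> \<equiv> restrict_space (lebesgue_pow m) \<Theta>"

text \<open>
  Measurability in \<open>(\<theta>, x\<^sup>n)\<close> jointly is implicit in integrating \<open>p\<^sub>\<theta>(x\<^sup>n)\<close> over \<open>\<theta>\<close> to obtain a density.
\<close>

definition parametric_model ::
  "'a measure \<Rightarrow> nat \<Rightarrow> (nat \<Rightarrow> real) set \<Rightarrow> ((nat \<Rightarrow> real) \<Rightarrow> 'a strategy) \<Rightarrow> bool" where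
  "parametric_model N m \<Theta> p \<longleftrightarrow>
     \<Theta> \<in> sets (lebesgue_pow m) \<and>
     (\<forall>\<theta>\<in>\<Theta>. pred_strategy N (p \<theta>)) \<and>
     (\<forall>n. (\<lambda>(\<theta>, x). joint_density (p \<theta>) n x)
            \<in> borel_measurable (param_space m \<Theta> \<Otimes>\<^sub>M (\<Pi>\<^sub>M i\<in>{0..<n}. N)))"

definition prior_density :: "nat \<Rightarrow> (nat \<Rightarrow> real) set \<Rightarrow> ((nat \<Rightarrow> real) \<Rightarrow> ennreal) \<Rightarrow> bool" where
  "prior_density m \<Theta> w \<longleftrightarrow>
     w \<in> borel_measurable (param_space m \<Theta>) \<and> (\<integral>\<^sup>+\<theta>. w \<theta> \<partial>param_space m \<Theta>) = 1"

definition prior_measure ::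
  "nat \<Rightarrow> (nat \<Rightarrow> real) set \<Rightarrow> ((nat \<Rightarrow> real) \<Rightarrow> ennreal) \<Rightarrow> (nat \<Rightarrow> real) measure" where
  "prior_measure m \<Theta> w = density (param_space m \<Theta>) w"

definition bayes_joint_density ::
  "nat \<Rightarrow> (nat \<Rightarrow> real) set \<Rightarrow> ((nat \<Rightarrow> real) \<Rightarrow> ennreal) \<Rightarrow> ((nat \<Rightarrow> real) \<Rightarrow> 'a strategy)
    \<Rightarrow> nat \<Rightarrow> (nat \<Rightarrow> 'a) \<Rightarrow> ennreal" where
  "bayes_joint_density m \<Theta> w p n x =
     (\<integral>\<^sup>+\<theta>. joint_density (p \<theta>) n x * w \<theta> \<partial>param_space m \<Theta>)"

text \<open>
  The quotient defining the conditionals is meaningful only where the joint density of the history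
  is neither 0 nor infinite. At the remaining histories, which have probability 0 under the Bayesian
  strategy, the conditionals are those of an arbitrary prediction strategy. They still matter:
  another model may give such a history positive density, and the switch distribution then uses them.
\<close>

definition bayes_strategy ::
  "'a measure \<Rightarrow> nat \<Rightarrow> (nat \<Rightarrow> real) set \<Rightarrow> ((nat \<Rightarrow> real) \<Rightarrow> ennreal)
    \<Rightarrow> ((nat \<Rightarrow> real) \<Rightarrow> 'a strategy) \<Rightarrow> 'a strategy \<Rightarrow> bool" where
  "bayes_strategy N m \<Theta> w p pbar \<longleftrightarrow>
     pred_strategy N pbar \<and>
     (\<forall>n. \<forall>x \<in> space (\<Pi>\<^sub>M i\<in>{0..<n}. N). \<forall>y \<in> space N.
        0 < bayes_joint_density m \<Theta> w p n x \<and> bayes_joint_density m \<Theta> w p n x < \<infinity> \<longrightarrow>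
        pbar n x y =
          bayes_joint_density m \<Theta> w p (Suc n) (x(n := y)) / bayes_joint_density m \<Theta> w p n x)"

section \<open>The switch distribution\<close>

text \<open>The element \<open>((t\<^sub>1,k\<^sub>1), \<dots>, (t\<^sub>m,k\<^sub>m))\<close>; note that list positions start at 0.\<close>

definition switch_seqs :: "(nat \<times> nat) list set" where
  "switch_seqs = {s. s \<noteq> [] \<and> fst (s ! 0) = 0 \<and> sorted_wrt (<) (map fst s) \<and>
                     (\<forall>(t, k) \<in> set s. 0 < k)}"

text \<open>\<open>switch_index s n\<close> is \<open>K\<^sub>n\<^sub>+\<^sub>1(s)\<close>.\<close>

definition switch_index :: "(nat \<times> nat) list \<Rightarrow> nat \<Rightarrow> nat" where
  "switch_index s n = snd (s ! (THE i. i < length s \<and> fst (s ! i) \<le> n \<and>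
                                       (Suc i = length s \<or> n < fst (s ! Suc i))))"

lemma switch_index_unique:
  assumes "s \<in> switch_seqs"
  shows "\<exists>!i. i < length s \<and> fst (s ! i) \<le> n \<and> (Suc i = length s \<or> n < fst (s ! Suc i))"
proof -
  have s: "s \<noteq> []" "fst (s ! 0) = 0"
    and mono: "\<And>i j. i < j \<Longrightarrow> j < length s \<Longrightarrow> fst (s ! i) < fst (s ! j)"
    using assms by (auto simp: switch_seqs_def sorted_wrt_iff_nth_less)
  define I where "I = {i. i < length s \<and> fst (s ! i) \<le> n}"
  have fin: "finite I" and ne: "I \<noteq> {}"
    using s by (auto simp: I_def)
  have "Max I \<in> I"
    using fin ne by (rule Max_in)
  moreover have "Suc (Max I) \<notin> I"
    using Max_ge[OF fin, of "Suc (Max I)"] by auto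
  ultimately have ex: "Max I < length s \<and> fst (s ! Max I) \<le> n \<and>
      (Suc (Max I) = length s \<or> n < fst (s ! Suc (Max I)))"
    by (auto simp: I_def)
  have le: "j \<le> i" if "i < length s" "Suc i = length s \<or> n < fst (s ! Suc i)"
    "j < length s" "fst (s ! j) \<le> n" for i j
  proof (rule ccontr)
    assume "\<not> j \<le> i"
    then have "Suc i < length s" "Suc i = j \<or> Suc i < j"
      using that(3) by auto
    then have "fst (s ! Suc i) \<le> fst (s ! j)"
      using mono[of "Suc i" j] that(3) by auto
    then show False
      using that \<open>Suc i < length s\<close> by auto
  qed
  show ?thesis
    using ex by (rule ex1I) (meson ex le le_antisym)
qed

definition switch_strategy :: "(nat \<Rightarrow> 'a strategy) \<Rightarrow> (nat \<times> nat) list \<Rightarrow> 'a strategy" where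
  "switch_strategy pbar s n x y = pbar (switch_index s n) n x y"

definition switch_density ::
  "(nat \<Rightarrow> 'a strategy) \<Rightarrow> (nat \<times> nat) list pmf \<Rightarrow> nat \<Rightarrow> (nat \<Rightarrow> 'a) \<Rightarrow> ennreal" where
  "switch_density pbar \<pi> n x =
     (\<integral>\<^sup>+s. joint_density (switch_strategy pbar s) n x * ennreal (pmf \<pi> s) \<partial>count_space switch_seqs)"

text \<open>\<open>switch_posterior pbar \<pi> k n x\<close> is \<open>\<pi>(K\<^sub>n\<^sub>+\<^sub>1 = k | x\<^sup>n)\<close>, and 0 where the denominator vanishes.\<close>

definition switch_posterior ::
  "(nat \<Rightarrow> 'a strategy) \<Rightarrow> (nat \<times> nat) list pmf \<Rightarrow> nat \<Rightarrow> nat \<Rightarrow> (nat \<Rightarrow> 'a) \<Rightarrow> ennreal" where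
  "switch_posterior pbar \<pi> k n x =
     (\<integral>\<^sup>+s. joint_density (switch_strategy pbar s) n x * ennreal (pmf \<pi> s)
        \<partial>count_space {s \<in> switch_seqs. switch_index s n = k}) / switch_density pbar \<pi> n x"

definition switch_extensions :: "(nat \<times> nat) list \<Rightarrow> (nat \<times> nat) list set" where
  "switch_extensions s =
     {s' \<in> switch_seqs. length s < length s' \<and> (\<forall>i < length s. s' ! i = s ! i)}"

end

theory Submission
  imports Defs
begin

text \<open>
  Fix \<open>k\<close> and let \<open>P\<close> be the law of the Bayesian strategy of model \<open>k\<close>, with joint density \<open>p\<close>. Since \<open>P\<close>
  is the mixture of the laws \<open>P\<^sub>\<theta>\<close> under the prior \<open>w\<close> (\<open>bayes_strategy_mixture\<close>), an event that is null
  under \<open>P\<close> is null under \<open>P\<^sub>\<theta>\<close> for \<open>w\<close>-almost all \<open>\<theta>\<close>. So it is enough to prove the convergence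
  \<open>P\<close>-almost surely.

  The posterior probability of \<open>K\<^sub>n\<^sub>+\<^sub>1 \<noteq> k\<close> is the quotient of \<open>\<Sum> q\<^sub>s(x\<^sup>n) \<pi>(s)\<close>, summed over the switching
  sequences \<open>s\<close> that do not use \<open>k\<close> at that time, by the full sum. The full sum is at least
  \<open>\<pi>((0,k)) p(x\<^sup>n)\<close>. In the numerator, group the sequences by their truncation at time \<open>n\<close>, on which
  \<open>q\<^sub>s(x\<^sup>n)\<close> and \<open>K\<^sub>n\<^sub>+\<^sub>1\<close> depend. By the hypothesis on extensions, the group of \<open>s\<close> has prior mass at most
  \<open>(1 + c) \<pi>(s)\<close>, so the numerator is at most \<open>(1 + c) r(x\<^sup>n)\<close>, where \<open>r\<close> is the sum over all sequences
  whose last strategy is not \<open>k\<close> (\<open>nn_integral_other_index_le\<close>). This index set does not depend on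
  \<open>n\<close>, so \<open>r\<close> is the density of one finite measure \<open>Q\<close>, and it remains to see that \<open>r / p\<close> tends to 0
  \<open>P\<close>-almost surely.

  For laws on sequences with densities on all finite histories, the ratio of the densities tends to 0
  \<open>P\<close>-almost surely if and only if the laws are mutually singular (\<open>singular_imp_ratio_vanishes\<close>,
  \<open>ratio_vanishes_imp_singular\<close>); both directions come from a maximal inequality for likelihood ratios.
  The equivalence is used back and forth. A sequence \<open>s\<close> whose last strategy is \<open>k' \<noteq> k\<close> agrees with \<open>k'\<close>
  from some time on. By hypothesis its futures from then on are singular to those of \<open>k\<close>, after every
  history; hence the ratio of the future densities vanishes, hence so does the ratio of the full
  densities, and \<open>Q\<^sub>s\<close> is singular to \<open>P\<close> (\<open>singular_futures_imp_singular\<close>). There are countably many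
  \<open>s\<close>, so the mixture \<open>Q\<close> is singular to \<open>P\<close> (\<open>mutually_singular_bind\<close>), and \<open>r / p\<close> tends to 0.
\<close>

section \<open>Events approximated by cylinders\<close>

text \<open>
  The approximable events contain the generating algebra and form a \<open>\<sigma>\<close>-algebra: complements
  preserve the symmetric difference, a finite union adds up the errors, and a countable union is
  approximated in measure by its finite subunions.
\<close>

lemma finite_measure_approx_by_algebra:
  assumes "finite_measure M" and alg: "algebra (space M) G" and gen: "sets M = sigma_sets (space M) G"
    and B: "B \<in> sets M" and e: "0 < (e::real)"
  shows "\<exists>C\<in>G. measure M (sym_diff B C) < e"
proof -
  interpret finite_measure M by fact
  interpret G: algebra "space M" G by fact
  have G_sets[measurable_dest]: "C \<in> G \<Longrightarrow> C \<in> sets M" for C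
    by (simp add: gen)
  define approx where "approx B \<longleftrightarrow> B \<in> sets M \<and> (\<forall>e>0. \<exists>C\<in>G. measure M (sym_diff B C) < e)" for B
  have approx_Un: "approx (A \<union> B)" if A: "approx A" and B: "approx B" for A B
    unfolding approx_def
  proof (intro conjI allI impI)
    show "A \<union> B \<in> sets M" using A B by (auto simp: approx_def)
    fix e :: real assume "0 < e"
    then obtain C D where C: "C \<in> G" "measure M (sym_diff A C) < e / 2"
      and D: "D \<in> G" "measure M (sym_diff B D) < e / 2"
      using A B unfolding approx_def by (meson half_gt_zero)
    have [measurable]: "A \<in> sets M" "B \<in> sets M" "C \<in> sets M" "D \<in> sets M"
      using A B C D G_sets by (auto simp: approx_def)
    have "measure M (sym_diff (A \<union> B) (C \<union> D)) \<le> measure M (sym_diff A C \<union> sym_diff B D)"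
      by (intro finite_measure_mono) auto
    also have "\<dots> \<le> measure M (sym_diff A C) + measure M (sym_diff B D)"
      by (intro measure_Un_le) auto
    also have "\<dots> < e" using C D by simp
    finally show "\<exists>C\<in>G. measure M (sym_diff (A \<union> B) C) < e"
      using C D by auto
  qed
  have "approx B"
    using B unfolding gen
  proof (induction rule: sigma_sets.induct)
    case (Basic a) then show ?case
      by (auto simp: approx_def G_sets intro!: bexI[of _ a])
  next
    case Empty show ?case by (auto simp: approx_def intro!: bexI[of _ "{}"])
  next
    case (Compl a)
    show ?case unfolding approx_def
    proof (intro conjI allI impI)
      show "space M - a \<in> sets M" using Compl.IH by (auto simp: approx_def)
      fix e :: real assume "0 < e"
      then obtain C where C: "C \<in> G" "measure M (sym_diff a C) < e"
        using Compl.IH by (auto simp: approx_def)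
      have "sym_diff (space M - a) (space M - C) = sym_diff a C"
        using sets.sets_into_space[of a M] sets.sets_into_space[OF G_sets[OF C(1)]] Compl.IH
        by (auto simp: approx_def)
      then show "\<exists>C\<in>G. measure M (sym_diff (space M - a) C) < e"
        using C by (intro bexI[of _ "space M - C"]) auto
    qed
  next
    case (Union A)
    have [measurable]: "A i \<in> sets M" for i using Union.IH by (auto simp: approx_def)
    have fin: "approx (\<Union>i<n. A i)" for n
    proof (induction n)
      case 0 show ?case by (auto simp: approx_def intro!: bexI[of _ "{}"])
    next
      case (Suc n) with Union.IH[of n] approx_Un show ?case
        by (simp add: lessThan_Suc Un_commute)
    qed
    show ?case unfolding approx_def
    proof (intro conjI allI impI)
      show "(\<Union>i. A i) \<in> sets M" by auto
      fix e :: real assume e: "0 < e"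
      have "(\<lambda>n. measure M (\<Union>i<n. A i)) \<longlonglongrightarrow> measure M (\<Union>n. \<Union>i<n. A i)"
        by (intro finite_Lim_measure_incseq monoI UN_mono) auto
      also have "(\<Union>n. \<Union>i<n. A i) = (\<Union>i. A i)" by auto
      finally have "\<forall>\<^sub>F n in sequentially. measure M (\<Union>i. A i) - e/2 < measure M (\<Union>i<n. A i)"
        using e by (intro order_tendstoD) auto
      then obtain n where n: "measure M (\<Union>i. A i) - e/2 < measure M (\<Union>i<n. A i)"
        by (meson eventually_happens sequentially_bot)
      obtain C where C: "C \<in> G" "measure M (sym_diff (\<Union>i<n. A i) C) < e / 2"
        using fin[of n] e unfolding approx_def by (meson half_gt_zero)
      have [measurable]: "C \<in> sets M" using C G_sets by auto
      have "measure M (sym_diff (\<Union>i. A i) C) \<le> measure M (((\<Union>i. A i) - (\<Union>i<n. A i)) \<union> sym_diff (\<Union>i<n. A i) C)"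
        by (intro finite_measure_mono) auto
      also have "\<dots> \<le> measure M ((\<Union>i. A i) - (\<Union>i<n. A i)) + measure M (sym_diff (\<Union>i<n. A i) C)"
        by (intro measure_Un_le) auto
      also have "measure M ((\<Union>i. A i) - (\<Union>i<n. A i)) = measure M (\<Union>i. A i) - measure M (\<Union>i<n. A i)"
        by (intro finite_measure_Diff) auto
      finally show "\<exists>C\<in>G. measure M (sym_diff (\<Union>i. A i) C) < e"
        using C n by (intro bexI[of _ C]) auto
    qed
  qed
  then show ?thesis using e by (simp add: approx_def)
qed

abbreviation histories :: "'a measure \<Rightarrow> nat \<Rightarrow> (nat \<Rightarrow> 'a) measure" where
  "histories N n \<equiv> \<Pi>\<^sub>M i\<in>{0..<n}. N"

abbreviation outcome_seqs :: "'a measure \<Rightarrow> (nat \<Rightarrow> 'a) measure" where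
  "outcome_seqs N \<equiv> \<Pi>\<^sub>M i\<in>UNIV. N"

abbreviation initial :: "nat \<Rightarrow> (nat \<Rightarrow> 'a) \<Rightarrow> nat \<Rightarrow> 'a" where
  "initial n \<omega> \<equiv> restrict \<omega> {0..<n}"

text \<open>
  The \<open>\<sigma>\<close>-algebra of the events decided by the first \<open>n\<close> outcomes, as a measurable space on whole
  sequences.
\<close>

definition past :: "'a measure \<Rightarrow> nat \<Rightarrow> (nat \<Rightarrow> 'a) measure" where
  "past N n = vimage_algebra (space (outcome_seqs N)) (initial n) (histories N n)"

lemma measurable_initial[measurable]: "{0..<n} \<subseteq> I \<Longrightarrow> initial n \<in> measurable (\<Pi>\<^sub>M i\<in>I. N) (histories N n)"
  by (intro measurable_restrict_subset)

lemma measurable_initial'[measurable]: "n \<le> m \<Longrightarrow> initial n \<in> measurable (histories N m) (histories N n)"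
  by (rule measurable_initial) auto

lemma space_past[simp]: "space (past N n) = space (outcome_seqs N)"
  by (simp add: past_def)

lemma initial_initial: "m \<le> n \<Longrightarrow> initial m (initial n \<omega>) = initial m \<omega>"
  by (auto simp: fun_eq_iff)

lemma sets_past: "sets (past N n) = {initial n -` C \<inter> space (outcome_seqs N) | C. C \<in> sets (histories N n)}"
  unfolding past_def
  by (intro sets_vimage_algebra2) (auto simp: space_PiM)

lemma sets_past_le: "sets (past N n) \<subseteq> sets (outcome_seqs N)"
  unfolding sets_past by auto

lemma past_mono: assumes "m \<le> n" shows "sets (past N m) \<subseteq> sets (past N n)"
proof
  fix E assume "E \<in> sets (past N m)"
  then obtain C where C[measurable]: "C \<in> sets (histories N m)" and E: "E = initial m -` C \<inter> space (outcome_seqs N)"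
    unfolding sets_past by auto
  have "initial m -` C \<inter> space (histories N n) \<in> sets (histories N n)"
    using assms by (intro measurable_sets[OF measurable_initial']) auto
  moreover have "E = initial n -` (initial m -` C \<inter> space (histories N n)) \<inter> space (outcome_seqs N)"
    using assms unfolding E by (auto simp: initial_initial space_PiM simp del: restrict_apply intro!: restrict_PiE_iff[THEN iffD2])
  ultimately show "E \<in> sets (past N n)"
    unfolding sets_past by blast
qed

lemma algebra_past: "algebra (space (outcome_seqs N)) (\<Union>n. sets (past N n))"
proof (rule algebra_iff_Un[THEN iffD2], intro conjI ballI)
  show "(\<Union>n. sets (past N n)) \<subseteq> Pow (space (outcome_seqs N))"
    using sets_past_le sets.sets_into_space by blast
  show "{} \<in> (\<Union>n. sets (past N n))" by auto
  fix A assume "A \<in> (\<Union>n. sets (past N n))"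
  then obtain n where n: "A \<in> sets (past N n)" by auto
  then show "space (outcome_seqs N) - A \<in> (\<Union>n. sets (past N n))"
    using sets.compl_sets[OF n] by auto
  fix B assume "B \<in> (\<Union>n. sets (past N n))"
  then obtain m where m: "B \<in> sets (past N m)" by auto
  have "A \<union> B \<in> sets (past N (max m n))"
    using n m past_mono[of n "max m n" N] past_mono[of m "max m n" N] by auto
  then show "A \<union> B \<in> (\<Union>n. sets (past N n))" by blast
qed

lemma sets_outcome_seqs_eq_past:
  "sets (outcome_seqs N) = sigma_sets (space (outcome_seqs N)) (\<Union>n. sets (past N n))"
proof (intro antisym sets.sigma_sets_subset)
  show "sets (outcome_seqs N) \<subseteq> sigma_sets (space (outcome_seqs N)) (\<Union>n. sets (past N n))"
    unfolding sets_PiM_single space_PiM[symmetric]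
  proof (intro sigma_sets_mono', safe)
    fix i A assume A[measurable]: "A \<in> sets N"
    have "{f \<in> space (outcome_seqs N). f i \<in> A} =
        initial (Suc i) -` {f \<in> space (histories N (Suc i)). f i \<in> A} \<inter> space (outcome_seqs N)"
      by (auto simp: space_PiM)
    moreover have "{f \<in> space (histories N (Suc i)). f i \<in> A} \<in> sets (histories N (Suc i))"
      by measurable
    ultimately have "{f \<in> space (outcome_seqs N). f i \<in> A} \<in> sets (past N (Suc i))"
      unfolding sets_past by blast
    then show "{f \<in> space (outcome_seqs N). f i \<in> A} \<in> (\<Union>n. sets (past N n))" by blast
  qed
qed (use sets_past_le in blast)

section \<open>Likelihood ratios and mutual singularity\<close>

text \<open>
  Finite measures rather than probability measures, because the part of the switch distribution
  contributed by a set of switching sequences is to be described by the same notion.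
\<close>

definition has_densities ::
  "'a measure \<Rightarrow> (nat \<Rightarrow> 'a) measure \<Rightarrow> (nat \<Rightarrow> (nat \<Rightarrow> 'a) \<Rightarrow> ennreal) \<Rightarrow> bool" where
  "has_densities N P p \<longleftrightarrow> finite_measure P \<and> sets P = sets (outcome_seqs N) \<and>
     (\<forall>n. p n \<in> borel_measurable (histories N n) \<and>
          distr P (histories N n) (initial n) = density (histories N n) (p n))"

text \<open>
  The likelihood ratio \<open>q(x\<^sup>n) / p(x\<^sup>n)\<close> tends to 0. Stated without a quotient, it makes sense at
  histories where one of the densities is 0 or infinite.
\<close>

definition ratio_vanishes ::
  "(nat \<Rightarrow> (nat \<Rightarrow> 'a) \<Rightarrow> ennreal) \<Rightarrow> (nat \<Rightarrow> (nat \<Rightarrow> 'a) \<Rightarrow> ennreal) \<Rightarrow> (nat \<Rightarrow> 'a) \<Rightarrow> bool" where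
  "ratio_vanishes q p \<omega> \<longleftrightarrow>
     (\<forall>M::nat. \<forall>\<^sub>F n in sequentially. of_nat M * q n (initial n \<omega>) \<le> p n (initial n \<omega>))"

lemma has_densitiesD:
  assumes "has_densities N P p"
  shows "finite_measure P" "sets P = sets (outcome_seqs N)" "space P = space (outcome_seqs N)"
    "p n \<in> borel_measurable (histories N n)"
    "distr P (histories N n) (initial n) = density (histories N n) (p n)"
    "(\<lambda>\<omega>. p n (initial n \<omega>)) \<in> borel_measurable (outcome_seqs N)"
proof -
  show *: "finite_measure P" "sets P = sets (outcome_seqs N)"
    "distr P (histories N n) (initial n) = density (histories N n) (p n)"
    and [measurable]: "p n \<in> borel_measurable (histories N n)"
    using assms by (auto simp: has_densities_def)
  show "space P = space (outcome_seqs N)" using *(2) by (rule sets_eq_imp_space_eq)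
  show "(\<lambda>\<omega>. p n (initial n \<omega>)) \<in> borel_measurable (outcome_seqs N)"
    by (rule measurable_compose[OF measurable_initial]) auto
qed

lemma has_densities_emeasure:
  assumes P: "has_densities N P p" and C[measurable]: "C \<in> sets (histories N n)"
  shows "emeasure P (initial n -` C \<inter> space (outcome_seqs N)) =
    (\<integral>\<^sup>+x. p n x * indicator C x \<partial>histories N n)"
proof -
  note [measurable_cong] = has_densitiesD(2)[OF P] and [measurable] = has_densitiesD(4)[OF P]
  have "emeasure P (initial n -` C \<inter> space (outcome_seqs N)) = emeasure (distr P (histories N n) (initial n)) C"
    by (subst emeasure_distr) (auto simp: has_densitiesD(3)[OF P])
  also have "\<dots> = (\<integral>\<^sup>+x. p n x * indicator C x \<partial>histories N n)"
    unfolding has_densitiesD(5)[OF P] by (intro emeasure_density) auto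
  finally show ?thesis .
qed

text \<open>
  The inequality is assumed along sequences, whereas the measures are integrals over histories. So
  the base of the cylinder \<open>E\<close> is first cut down to the histories that satisfy the inequality, which
  leaves \<open>E\<close> unchanged.
\<close>

lemma past_emeasure_le:
  fixes a c :: ennreal
  assumes P: "has_densities N P p" and Q: "has_densities N Q q"
    and E: "E \<in> sets (past N n)"
    and le: "\<And>\<omega>. \<omega> \<in> E \<Longrightarrow> a * p n (initial n \<omega>) \<le> c * q n (initial n \<omega>)"
  shows "a * emeasure P E \<le> c * emeasure Q E"
proof -
  note [measurable] = has_densitiesD(4)[OF P, of n] has_densitiesD(4)[OF Q, of n]
  obtain C where C[measurable]: "C \<in> sets (histories N n)"
    and E: "E = initial n -` C \<inter> space (outcome_seqs N)"
    using E unfolding sets_past by auto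
  define C' where "C' = C \<inter> {x \<in> space (histories N n). a * p n x \<le> c * q n x}"
  have [measurable]: "C' \<in> sets (histories N n)" unfolding C'_def by measurable
  have E': "E = initial n -` C' \<inter> space (outcome_seqs N)"
    using le sets.sets_into_space[OF C] unfolding E C'_def by auto
  have "a * emeasure P E = (\<integral>\<^sup>+x. a * (p n x * indicator C' x) \<partial>histories N n)"
    unfolding E' by (subst has_densities_emeasure[OF P]) (auto intro!: nn_integral_cmult[symmetric])
  also have "\<dots> \<le> (\<integral>\<^sup>+x. c * (q n x * indicator C' x) \<partial>histories N n)"
    by (intro nn_integral_mono) (auto simp: C'_def split: split_indicator)
  also have "\<dots> = c * emeasure Q E"
    unfolding E' by (subst has_densities_emeasure[OF Q]) (auto intro!: nn_integral_cmult)
  finally show ?thesis .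
qed

text \<open>
  Decompose \<open>B\<close> by the first time \<open>n \<ge> m\<close> at which the inequality between the densities holds. Each
  piece is decided by the first \<open>n\<close> outcomes, so the inequality carries over from the densities to the
  measures of the piece.
\<close>

lemma maximal_inequality:
  fixes a c :: ennreal
  assumes P: "has_densities N P p" and Q: "has_densities N Q q"
    and A: "A \<in> sets (past N m)"
  defines "B \<equiv> {\<omega>\<in>A. \<exists>n\<ge>m. a * p n (initial n \<omega>) \<le> c * q n (initial n \<omega>)}"
  shows "a * emeasure P B \<le> c * emeasure Q B" and "B \<in> sets (outcome_seqs N)"
proof -
  define D where "D n = (if n < m then {} else {\<omega>\<in>A. a * p n (initial n \<omega>) \<le> c * q n (initial n \<omega>)})" for n
  have D: "D n \<in> sets (past N n)" for n
  proof (cases "n < m")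
    case False
    note [measurable] = has_densitiesD(4)[OF P, of n] has_densitiesD(4)[OF Q, of n]
    have "{x\<in>space (histories N n). a * p n x \<le> c * q n x} \<in> sets (histories N n)"
      by measurable
    then have "initial n -` {x\<in>space (histories N n). a * p n x \<le> c * q n x} \<inter> space (outcome_seqs N) \<in> sets (past N n)"
      unfolding sets_past by blast
    moreover have "A \<in> sets (past N n)"
      using A past_mono[of m n N] False by auto
    ultimately have "A \<inter> (initial n -` {x\<in>space (histories N n). a * p n x \<le> c * q n x} \<inter> space (outcome_seqs N)) \<in> sets (past N n)"
      by auto
    also have "A \<inter> (initial n -` {x\<in>space (histories N n). a * p n x \<le> c * q n x} \<inter> space (outcome_seqs N)) = D n"
    proof (rule set_eqI)
      fix \<omega>
      have "\<omega> \<in> A \<Longrightarrow> \<omega> \<in> space (outcome_seqs N)"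
        using sets.sets_into_space[OF A] by auto
      moreover from this have "\<omega> \<in> A \<Longrightarrow> initial n \<omega> \<in> space (histories N n)"
        using measurable_space[OF measurable_initial[of n UNIV N]] by blast
      ultimately show "\<omega> \<in> A \<inter> (initial n -` {x\<in>space (histories N n). a * p n x \<le> c * q n x} \<inter> space (outcome_seqs N))
          \<longleftrightarrow> \<omega> \<in> D n"
        using False unfolding D_def by (simp del: restrict_apply) blast
    qed
    finally show ?thesis .
  qed (simp add: D_def)
  have dis: "disjointed D n \<in> sets (past N n)" for n
    unfolding disjointed_def
  proof (intro sets.Diff sets.finite_UN D)
    show "D i \<in> sets (past N n)" if "i \<in> {0..<n}" for i
      using D[of i] past_mono[of i n N] that by auto
  qed simp
  have dis': "disjointed D n \<in> sets (outcome_seqs N)" for n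
    using dis sets_past_le by blast
  have B: "B = (\<Union>n. disjointed D n)"
    unfolding UN_disjointed_eq by (auto simp: B_def D_def not_less)
  show "B \<in> sets (outcome_seqs N)" unfolding B using dis' by blast
  have "a * emeasure P B = a * (\<Sum>n. emeasure P (disjointed D n))"
    unfolding B using dis' has_densitiesD(2)[OF P]
    by (subst suminf_emeasure) (auto simp: disjoint_family_disjointed)
  also have "\<dots> = (\<Sum>n. a * emeasure P (disjointed D n))" by simp
  also have "\<dots> \<le> (\<Sum>n. c * emeasure Q (disjointed D n))"
  proof (intro suminf_le past_emeasure_le[OF P Q dis])
    show "a * p n (initial n \<omega>) \<le> c * q n (initial n \<omega>)" if "\<omega> \<in> disjointed D n" for n \<omega>
      using that disjointed_subset[of D n] by (auto simp: D_def simp del: restrict_apply split: if_splits)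
  qed auto
  also have "\<dots> = c * (\<Sum>n. emeasure Q (disjointed D n))" by simp
  also have "\<dots> = c * emeasure Q B"
    unfolding B using dis' has_densitiesD(2)[OF Q]
    by (subst suminf_emeasure) (auto simp: disjoint_family_disjointed)
  finally show "a * emeasure P B \<le> c * emeasure Q B" .
qed

lemma finite_measure_sum:
  assumes P: "finite_measure P" and Q: "finite_measure Q" and sets: "sets P = sets Q"
  obtains R where "finite_measure R" "sets R = sets P"
    "\<And>A. A \<in> sets P \<Longrightarrow> emeasure R A = emeasure P A + emeasure Q A"
proof
  define R where "R = measure_of (space P) (sets P) (\<lambda>A. emeasure P A + emeasure Q A)"
  show R: "sets R = sets P" by (simp add: R_def)
  show em: "emeasure R A = emeasure P A + emeasure Q A" if "A \<in> sets P" for A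
    unfolding R_def
  proof (rule emeasure_measure_of_sigma[OF sets.sigma_algebra_axioms _ _ that])
    show "positive (sets P) (\<lambda>A. emeasure P A + emeasure Q A)" by (simp add: positive_def)
    show "countably_additive (sets P) (\<lambda>A. emeasure P A + emeasure Q A)"
    proof (rule countably_additiveI)
      fix A :: "nat \<Rightarrow> _" assume "range A \<subseteq> sets P" "disjoint_family A"
      then show "(\<Sum>i. emeasure P (A i) + emeasure Q (A i)) = emeasure P (\<Union>i. A i) + emeasure Q (\<Union>i. A i)"
        using suminf_emeasure[of A P] suminf_emeasure[of A Q] sets
        by (simp add: suminf_add[symmetric])
    qed
  qed
  show "finite_measure R"
  proof
    show "emeasure R (space R) \<noteq> \<infinity>"
      using em[OF sets.top] sets_eq_imp_space_eq[OF R] finite_measure.emeasure_finite[OF P] finite_measure.emeasure_finite[OF Q]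
      by simp
  qed
qed

lemma measurable_eventually_dominated:
  assumes P: "has_densities N P p" and Q: "has_densities N Q q"
  shows "Measurable.pred (outcome_seqs N)
    (\<lambda>\<omega>. \<forall>\<^sub>F n in sequentially. of_nat M * q n (initial n \<omega>) \<le> p n (initial n \<omega>))"
proof -
  have *: "Measurable.pred (outcome_seqs N) (\<lambda>\<omega>. c * g \<omega> \<le> f \<omega>)"
    if [measurable]: "f \<in> borel_measurable (outcome_seqs N)" "g \<in> borel_measurable (outcome_seqs N)" for f g and c :: ennreal
    unfolding pred_def by (intro borel_measurable_le) measurable
  show ?thesis unfolding eventually_sequentially
    by (intro pred_intros_countable pred_intros_logic *
        has_densitiesD(6)[OF P] has_densitiesD(6)[OF Q] measurable_const) auto
qed

lemma measurable_ratio_vanishes: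
  assumes P: "has_densities N P p" and Q: "has_densities N Q q"
  shows "Measurable.pred (outcome_seqs N) (ratio_vanishes q p)"
  unfolding ratio_vanishes_def[abs_def]
  by (intro pred_intros_countable measurable_eventually_dominated[OF P Q])

text \<open>
  Let \<open>A\<close> carry \<open>Q\<close> and be null under \<open>P\<close>. A cylinder \<open>C\<close>, decided by time \<open>m\<close>, that approximates
  \<open>A\<close> under \<open>P + Q\<close> has small \<open>P\<close>-measure, and its complement \<open>C'\<close> has small \<open>Q\<close>-measure. On \<open>C'\<close> the
  maximal inequality bounds by \<open>M * Q(C')\<close> the probability under \<open>P\<close> that \<open>p \<le> M q\<close> at some time from
  \<open>m\<close> on. So the probability that this happens infinitely often is below every positive bound.
\<close>

lemma singular_imp_ratio_vanishes:
  assumes P: "has_densities N P p" and Q: "has_densities N Q q" and PQ: "mutually_singular P Q"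
  shows "AE \<omega> in P. ratio_vanishes q p \<omega>"
  unfolding ratio_vanishes_def
proof (rule AE_all_countable[THEN iffD2], rule)
  fix M :: nat
  have sQ[simp]: "sets Q = sets P" by (simp add: has_densitiesD(2)[OF P] has_densitiesD(2)[OF Q])
  interpret P: finite_measure P by (rule has_densitiesD(1)[OF P])
  interpret Q: finite_measure Q by (rule has_densitiesD(1)[OF Q])
  have spQ: "space Q = space P" by (simp add: has_densitiesD(3)[OF P] has_densitiesD(3)[OF Q])
  define bad where "bad = {\<omega>\<in>space (outcome_seqs N).
    \<not> (\<forall>\<^sub>F n in sequentially. of_nat M * q n (initial n \<omega>) \<le> p n (initial n \<omega>))}"
  have "bad \<in> sets (outcome_seqs N)"
    unfolding bad_def using measurable_eventually_dominated[OF P Q, of M] by (intro sets.sets_Collect_neg) (simp add: pred_def)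
  then have bad[measurable]: "bad \<in> sets P"
    by (simp add: has_densitiesD(2)[OF P])
  have bad_frequently: "\<exists>n\<ge>m. 1 * p n (initial n \<omega>) \<le> of_nat M * q n (initial n \<omega>)" if "\<omega> \<in> bad" for \<omega> m
    using that unfolding bad_def eventually_sequentially
    by (simp del: restrict_apply) (meson linear)
  obtain A where A[measurable]: "A \<in> sets P" "emeasure P A = 0" "emeasure Q (space P - A) = 0"
    using PQ spQ by (auto simp: mutually_singular_def)
  obtain R where "finite_measure R" and R: "sets R = sets P"
    "\<And>A. A \<in> sets P \<Longrightarrow> emeasure R A = emeasure P A + emeasure Q A"
    using finite_measure_sum[OF P.finite_measure_axioms Q.finite_measure_axioms] has_densitiesD(2)[OF P] has_densitiesD(2)[OF Q] by metis
  interpret R: finite_measure R by fact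
  have spR: "space R = space (outcome_seqs N)"
    using R(1) has_densitiesD(2)[OF P] by (metis sets_eq_imp_space_eq)
  have R': "measure R A = measure P A + measure Q A" if "A \<in> sets P" for A
    using R(2)[OF that]
    by (metis P.emeasure_finite Q.emeasure_finite R.emeasure_eq_measure P.emeasure_eq_measure Q.emeasure_eq_measure
        ennreal_inj ennreal_plus measure_nonneg add_nonneg_nonneg)
  \<comment> \<open>The factor \<open>1 + M\<close> collects the error \<open>P(C) < e\<close> and the bound \<open>M * Q(C') < M * e\<close>.\<close>
  have small: "measure P bad \<le> e * (1 + M)" if e: "0 < e" for e :: real
  proof -
    have "\<exists>C\<in>\<Union>n. sets (past N n). measure R (sym_diff A C) < e"
      using algebra_past[of N] sets_outcome_seqs_eq_past[of N] has_densitiesD(2)[OF P] A R(1) spR e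
      by (intro finite_measure_approx_by_algebra) (auto intro: R.finite_measure_axioms)
    then obtain C m where C: "C \<in> sets (past N m)" and Ce: "measure R (sym_diff A C) < e"
      by auto
    have CP[measurable]: "C \<in> sets P" using C sets_past_le has_densitiesD(2)[OF P] by blast
    define C' where "C' = space P - C"
    have C': "C' \<in> sets (past N m)"
      unfolding C'_def using sets.compl_sets[OF C] has_densitiesD(3)[OF P] by simp
    have [measurable]: "C' \<in> sets P" unfolding C'_def by measurable
    have AQ: "measure Q (space P - A) = 0" using A(3) by (simp add: measure_def)
    have PC: "measure P C \<le> measure P (sym_diff A C)"
    proof -
      have "measure P C \<le> measure P (A \<union> sym_diff A C)" by (intro P.finite_measure_mono) auto
      also have "\<dots> \<le> measure P A + measure P (sym_diff A C)" by (intro measure_Un_le) auto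
      finally show ?thesis using A(2) by (simp add: measure_def)
    qed
    have QC: "measure Q C' \<le> measure Q (sym_diff A C)"
    proof -
      have "measure Q C' \<le> measure Q ((space P - A) \<union> sym_diff A C)"
        using spQ by (intro Q.finite_measure_mono) (auto simp: C'_def)
      also have "\<dots> \<le> measure Q (space P - A) + measure Q (sym_diff A C)"
        using spQ by (intro measure_Un_le) auto
      finally show ?thesis using AQ by simp
    qed
    have "measure R (sym_diff A C) = measure P (sym_diff A C) + measure Q (sym_diff A C)"
      by (intro R') auto
    then have PQe: "measure P C < e" "measure Q C' < e"
      using PC QC Ce measure_nonneg[of P "sym_diff A C"] measure_nonneg[of Q "sym_diff A C"]
      by linarith+
    define B where "B = {\<omega>\<in>C'. \<exists>n\<ge>m. 1 * p n (initial n \<omega>) \<le> of_nat M * q n (initial n \<omega>)}"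
    have B[measurable]: "B \<in> sets P"
      unfolding B_def has_densitiesD(2)[OF P] by (rule maximal_inequality[OF P Q C'])
    have "1 * emeasure P B \<le> of_nat M * emeasure Q B"
      unfolding B_def by (rule maximal_inequality[OF P Q C'])
    also have "\<dots> \<le> of_nat M * emeasure Q C'"
      by (intro mult_left_mono emeasure_mono) (auto simp: B_def)
    finally have "measure P B \<le> M * measure Q C'"
      by (simp add: P.emeasure_eq_measure Q.emeasure_eq_measure ennreal_of_nat_eq_real_of_nat ennreal_mult[symmetric])
    also have "\<dots> \<le> M * e" using PQe by (intro mult_left_mono) auto
    finally have "measure P B \<le> M * e" .
    moreover have "measure P bad \<le> measure P (C \<union> B)"
    proof (intro P.finite_measure_mono subsetI)
      fix \<omega> assume "\<omega> \<in> bad"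
      then show "\<omega> \<in> C \<union> B"
        using sets.sets_into_space[OF bad] bad_frequently[of \<omega> m] unfolding B_def C'_def by blast
    qed auto
    moreover have "measure P (C \<union> B) \<le> measure P C + measure P B"
      by (intro measure_Un_le) auto
    ultimately show ?thesis using PQe by (simp add: algebra_simps)
  qed
  have "measure P bad \<le> 0"
  proof (rule field_le_epsilon)
    fix e :: real assume "0 < e"
    then show "measure P bad \<le> 0 + e"
      using small[of "e / (1 + M)"] by simp
  qed
  then have "emeasure P bad = 0" using measure_nonneg[of P bad] by (simp add: P.emeasure_eq_measure)
  then have "AE \<omega> in P. \<omega> \<notin> bad" by (intro AE_not_in) (auto simp: null_sets_def)
  then show "AE \<omega> in P. \<forall>\<^sub>F n in sequentially. of_nat M * q n (initial n \<omega>) \<le> p n (initial n \<omega>)"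
    by (rule AE_mp, intro AE_I2) (auto simp: bad_def has_densitiesD(3)[OF P])
qed

text \<open>
  On the set \<open>G\<close> where the ratio vanishes, \<open>M q \<le> p\<close> holds at some time for every \<open>M\<close>. The maximal
  inequality from time 0 on, with the roles of the two laws exchanged, gives \<open>M * Q(G) \<le> P(\<Omega>)\<close> for
  every \<open>M\<close>, so \<open>Q(G) = 0\<close>, while \<open>P\<close> is carried by \<open>G\<close>.
\<close>

lemma ratio_vanishes_imp_singular:
  assumes P: "has_densities N P p" and Q: "has_densities N Q q"
    and v: "AE \<omega> in P. ratio_vanishes q p \<omega>"
  shows "mutually_singular P Q"
proof -
  note [measurable] = measurable_ratio_vanishes[OF P Q]
  have sQ[simp]: "sets Q = sets P" by (simp add: has_densitiesD(2)[OF P] has_densitiesD(2)[OF Q])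
  interpret P: finite_measure P by (rule has_densitiesD(1)[OF P])
  interpret Q: finite_measure Q by (rule has_densitiesD(1)[OF Q])
  have sp: "space P = space (outcome_seqs N)" "space Q = space (outcome_seqs N)"
    by (simp_all add: has_densitiesD(3)[OF P] has_densitiesD(3)[OF Q])
  define G where "G = {\<omega>\<in>space P. ratio_vanishes q p \<omega>}"
  have [measurable]: "G \<in> sets P"
    unfolding G_def sp has_densitiesD(2)[OF P] by measurable
  have "emeasure P (space P - G) = 0"
  proof -
    have "AE \<omega> in P. \<omega> \<notin> space P - G"
      using v by eventually_elim (auto simp: G_def)
    then have "space P - G \<in> null_sets P"
      by (subst AE_iff_null_sets) auto
    then show ?thesis by auto
  qed
  moreover have "emeasure Q G = 0"
  proof -
    have "of_nat M * emeasure Q G \<le> emeasure P (space P)" for M :: nat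
    proof -
      let ?B = "{\<omega>\<in>space (outcome_seqs N). \<exists>n\<ge>0. of_nat M * q n (initial n \<omega>) \<le> 1 * p n (initial n \<omega>)}"
      have "?B \<in> sets Q"
        unfolding has_densitiesD(2)[OF Q] space_past[of N 0, symmetric]
        by (rule maximal_inequality(2)[OF Q P sets.top])
      then have "of_nat M * emeasure Q G \<le> of_nat M * emeasure Q ?B"
      proof (intro mult_left_mono emeasure_mono)
        show "G \<subseteq> ?B"
        proof
          fix \<omega> assume \<omega>: "\<omega> \<in> G"
          then have "\<forall>\<^sub>F n in sequentially. of_nat M * q n (initial n \<omega>) \<le> p n (initial n \<omega>)"
            by (auto simp: G_def ratio_vanishes_def)
          then have "\<exists>n. of_nat M * q n (initial n \<omega>) \<le> p n (initial n \<omega>)"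
            by (rule eventually_happens'[OF sequentially_bot])
          moreover have "\<omega> \<in> space (outcome_seqs N)" using \<omega> unfolding G_def sp by blast
          ultimately show "\<omega> \<in> ?B" by simp
        qed
      qed auto
      also have "\<dots> \<le> 1 * emeasure P ?B"
        unfolding space_past[of N 0, symmetric] by (rule maximal_inequality(1)[OF Q P sets.top])
      also have "\<dots> \<le> emeasure P (space P)"
        by (simp add: emeasure_space)
      finally show ?thesis .
    qed
    then have *: "M * measure Q G \<le> measure P (space P)" for M :: nat
      by (simp add: P.emeasure_eq_measure Q.emeasure_eq_measure ennreal_of_nat_eq_real_of_nat ennreal_mult[symmetric])
    have "\<not> 0 < measure Q G"
    proof
      assume "0 < measure Q G"
      from reals_Archimedean3[OF this] show False using * by (meson not_le)
    qed
    then show ?thesis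
      using measure_nonneg[of Q G] by (simp add: Q.emeasure_eq_measure)
  qed
  ultimately show ?thesis
    unfolding mutually_singular_def
  proof (intro conjI bexI[of _ "space P - G"])
    have "space Q - (space P - G) = G"
      using sp unfolding G_def by blast
    with \<open>emeasure Q G = 0\<close> show "emeasure Q (space Q - (space P - G)) = 0" by simp
  qed auto
qed

section \<open>Densities of prediction strategies and of their mixtures\<close>

lemma histories_Suc_update:
  assumes "x \<in> space (histories N n)" "y \<in> space N"
  shows "x(n := y) \<in> space (histories N (Suc n))"
  using assms by (auto simp: space_PiM PiE_iff extensional_def)

lemma nn_integral_histories_Suc:
  assumes "sigma_finite_measure N" and f: "f \<in> borel_measurable (histories N (Suc n))"
  shows "(\<integral>\<^sup>+x. f x \<partial>histories N (Suc n)) = (\<integral>\<^sup>+x. \<integral>\<^sup>+y. f (x(n := y)) \<partial>N \<partial>histories N n)"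
proof -
  interpret product_sigma_finite "\<lambda>_::nat. N" by (intro product_sigma_finite.intro assms)
  have "{0..<Suc n} = insert n {0..<n}" by auto
  with f show ?thesis
    using product_nn_integral_insert[of "{0..<n}" n f] by simp
qed

lemma measurable_comb_initial:
  assumes "{0..<m} \<subseteq> I"
  shows "(\<lambda>(x, z). initial (n + m) (comb_seq n x z)) \<in>
    measurable (histories N n \<Otimes>\<^sub>M (\<Pi>\<^sub>M i\<in>I. N)) (histories N (n + m))"
  unfolding split_beta'
proof (rule measurable_restrict)
  fix j assume "j \<in> {0..<n + m}"
  show "(\<lambda>x. comb_seq n (fst x) (snd x) j) \<in> measurable (histories N n \<Otimes>\<^sub>M (\<Pi>\<^sub>M i\<in>I. N)) N"
  proof (cases "j < n")
    case True
    then have "(\<lambda>x. fst x j) \<in> measurable (histories N n \<Otimes>\<^sub>M (\<Pi>\<^sub>M i\<in>I. N)) N"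
      by (intro measurable_compose[OF measurable_fst] measurable_component_singleton) auto
    with True show ?thesis by (simp add: comb_seq_def)
  next
    case False
    then have "(\<lambda>x. snd x (j - n)) \<in> measurable (histories N n \<Otimes>\<^sub>M (\<Pi>\<^sub>M i\<in>I. N)) N"
      using \<open>j \<in> _\<close> assms by (intro measurable_compose[OF measurable_snd] measurable_component_singleton) auto
    with False show ?thesis by (simp add: comb_seq_def)
  qed
qed

lemma measurable_comb:
  "(\<lambda>(x, z). comb_seq n x z) \<in> measurable (histories N n \<Otimes>\<^sub>M outcome_seqs N) (outcome_seqs N)"
  unfolding split_beta'
proof (rule measurable_PiM_single')
  fix j :: nat
  have "(\<lambda>x. initial (n + Suc j) (comb_seq n (fst x) (snd x)) j) \<in> measurable (histories N n \<Otimes>\<^sub>M outcome_seqs N) N"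
    using measurable_compose[OF measurable_comb_initial[of "Suc j" UNIV n N] measurable_component_singleton[of j]]
    by (simp add: split_beta' del: restrict_apply)
  then show "(\<lambda>x. comb_seq n (fst x) (snd x) j) \<in> measurable (histories N n \<Otimes>\<^sub>M outcome_seqs N) N"
    by simp
qed (auto simp: space_PiM space_pair_measure comb_seq_def PiE_iff)

lemma initial_comb_initial: "initial (n + m) (comb_seq n x (initial m z)) = initial (n + m) (comb_seq n x z)"
  by (auto simp: fun_eq_iff comb_seq_def)

lemma initial_comb: "x \<in> space (histories N n) \<Longrightarrow> i \<le> n \<Longrightarrow> initial i (comb_seq n x z) = initial i x"
  by (auto simp: fun_eq_iff comb_seq_def)

lemma initial_histories: "x \<in> space (histories N n) \<Longrightarrow> initial n x = x"
  by (auto simp: space_PiM PiE_iff extensional_def fun_eq_iff)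

text \<open>
  Tonelli for the splitting of a history of length \<open>n + m\<close> into its first \<open>n\<close> and its last \<open>m\<close>
  outcomes, by induction on \<open>m\<close> with one coordinate split off at a time.
\<close>

lemma nn_integral_histories_add:
  assumes N: "sigma_finite_measure N" and f: "f \<in> borel_measurable (histories N (n + m))"
  shows "(\<integral>\<^sup>+x. f x \<partial>histories N (n + m)) =
    (\<integral>\<^sup>+x. \<integral>\<^sup>+z. f (initial (n + m) (comb_seq n x z)) \<partial>histories N m \<partial>histories N n)"
  using f
proof (induction m arbitrary: f)
  case 0
  interpret product_sigma_finite "\<lambda>_::nat. N" by (intro product_sigma_finite.intro N)
  show ?case
    by (auto simp: PiM_empty nn_integral_count_space_finite initial_comb initial_histories simp del: restrict_apply intro!: nn_integral_cong)
next
  case (Suc m)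
  note [measurable] = Suc.prems
  interpret sigma_finite_measure N by fact
  have upd: "(\<lambda>(x, y). x(n + m := y)) \<in> measurable (histories N (n + m) \<Otimes>\<^sub>M N) (histories N (Suc (n + m)))"
    unfolding split_beta' by (rule measurable_fun_upd[where J="{0..<n + m}"]) auto
  have m: "(\<lambda>x. \<integral>\<^sup>+y. f (x(n + m := y)) \<partial>N) \<in> borel_measurable (histories N (n + m))"
    using measurable_compose[OF upd] Suc.prems by (intro borel_measurable_nn_integral) (simp add: split_beta')
  have "(\<integral>\<^sup>+x. f x \<partial>histories N (n + Suc m)) = (\<integral>\<^sup>+x. \<integral>\<^sup>+y. f (x(n + m := y)) \<partial>N \<partial>histories N (n + m))"
    using Suc.prems by (simp add: nn_integral_histories_Suc[OF N])
  also have "\<dots> = (\<integral>\<^sup>+x. \<integral>\<^sup>+z. \<integral>\<^sup>+y. f ((initial (n + m) (comb_seq n x z))(n + m := y)) \<partial>N \<partial>histories N m \<partial>histories N n)"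
    by (rule Suc.IH[OF m])
  also have "\<dots> = (\<integral>\<^sup>+x. \<integral>\<^sup>+z. f (initial (n + Suc m) (comb_seq n x z)) \<partial>histories N (Suc m) \<partial>histories N n)"
  proof (rule nn_integral_cong)
    fix x assume x: "x \<in> space (histories N n)"
    have "(\<lambda>z. f (initial (n + Suc m) (comb_seq n x z))) \<in> borel_measurable (histories N (Suc m))"
      using measurable_compose[OF measurable_Pair1'[OF x] measurable_comb_initial[of "Suc m" "{0..<Suc m}" n N]]
      by (intro measurable_compose[OF _ Suc.prems]) (simp del: restrict_apply)
    moreover have "(initial (n + m) (comb_seq n x z))(n + m := y) = initial (n + Suc m) (comb_seq n x (z(m := y)))" for z y
      by (auto simp: fun_eq_iff comb_seq_def)
    ultimately show "(\<integral>\<^sup>+z. \<integral>\<^sup>+y. f ((initial (n + m) (comb_seq n x z))(n + m := y)) \<partial>N \<partial>histories N m) =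
      (\<integral>\<^sup>+z. f (initial (n + Suc m) (comb_seq n x z)) \<partial>histories N (Suc m))"
      by (subst nn_integral_histories_Suc[OF N]) (simp_all del: restrict_apply)
  qed
  finally show ?case .
qed

lemma joint_density_initial: "joint_density p n (initial n x) = joint_density p n x"
  unfolding joint_density_def by (intro prod.cong) (auto simp: initial_initial simp del: restrict_apply, auto)

lemma joint_density_0[simp]: "joint_density p 0 x = 1"
  by (simp add: joint_density_def)

lemma joint_density_Suc_update:
  assumes "x \<in> space (histories N n)"
  shows "joint_density p (Suc n) (x(n := y)) = joint_density p n x * p n x y"
proof -
  have "initial n (x(n := y)) = x"
    using assms by (auto simp: space_PiM PiE_iff extensional_def fun_eq_iff)
  moreover have "joint_density p n (x(n := y)) = joint_density p n x"
    using joint_density_initial[of p n "x(n := y)"] joint_density_initial[of p n x] calculation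
    by simp
  ultimately show ?thesis
    unfolding joint_density_def by simp
qed

lemma joint_density_comb:
  "joint_density p (n + m) (comb_seq n x z) = joint_density p n x * joint_density (future_strategy p n x) m z"
proof (induction m)
  case 0
  have "initial n (comb_seq n x z) = initial n x" by (auto simp: fun_eq_iff comb_seq_def)
  then show ?case
    using joint_density_initial[of p n "comb_seq n x z"] joint_density_initial[of p n x] by simp
next
  case (Suc m)
  have "comb_seq n x z (n + m) = z m" by (simp add: comb_seq_def)
  with Suc.IH show ?case
    by (simp add: joint_density_def future_strategy_def initial_comb_initial mult.assoc del: restrict_apply)
qed

lemma pred_strategy_measurable:
  assumes "pred_strategy N p" "f \<in> measurable M (histories N n)" "g \<in> measurable M N"
  shows "(\<lambda>x. p n (f x) (g x)) \<in> borel_measurable M"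
  using measurable_compose[OF measurable_Pair[OF assms(2,3)], of "\<lambda>(x, y). p n x y" borel] assms(1)
  by (auto simp: pred_strategy_def)

lemma measurable_joint_density:
  assumes p: "pred_strategy N p"
  shows "joint_density p n \<in> borel_measurable (histories N n)"
  unfolding joint_density_def
  by (intro borel_measurable_prod_ennreal pred_strategy_measurable[OF p] measurable_initial measurable_component_singleton) auto

lemma Int_stable_past: "Int_stable (\<Union>n. sets (past N n))"
  using algebra.Int_stable[OF algebra_past] .

lemma measure_eqI_past:
  assumes "finite_measure P" "sets P = sets (outcome_seqs N)" "sets Q = sets (outcome_seqs N)"
    and eq: "\<And>n E. E \<in> sets (past N n) \<Longrightarrow> emeasure P E = emeasure Q E"
  shows "P = Q"
proof (rule measure_eqI_generator_eq[where A="\<lambda>_. space (outcome_seqs N)"])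
  show "Int_stable (\<Union>n. sets (past N n))" by (rule Int_stable_past)
  show "(\<Union>n. sets (past N n)) \<subseteq> Pow (space (outcome_seqs N))"
    using sets_past_le sets.sets_into_space by blast
  show "sets P = sigma_sets (space (outcome_seqs N)) (\<Union>n. sets (past N n))"
    "sets Q = sigma_sets (space (outcome_seqs N)) (\<Union>n. sets (past N n))"
    using assms(2,3) sets_outcome_seqs_eq_past[of N] by metis+
  show "range (\<lambda>_. space (outcome_seqs N)) \<subseteq> (\<Union>n. sets (past N n))"
    using sets.top[of "past N _"] by auto
  show "emeasure P (space (outcome_seqs N)) \<noteq> \<infinity>"
    using finite_measure.emeasure_finite[OF assms(1)] by simp
qed (use eq in auto)

lemma has_densities_unique:
  assumes P: "has_densities N P p" and Q: "has_densities N Q q"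
    and eq: "\<And>n. AE x in histories N n. p n x = q n x"
  shows "P = Q"
proof (rule measure_eqI_past)
  show "finite_measure P" "sets P = sets (outcome_seqs N)" "sets Q = sets (outcome_seqs N)"
    using has_densitiesD[OF P] has_densitiesD[OF Q] by auto
  fix n E assume "E \<in> sets (past N n)"
  then obtain C where C: "C \<in> sets (histories N n)" "E = initial n -` C \<inter> space (outcome_seqs N)"
    unfolding sets_past by auto
  have "(\<integral>\<^sup>+x. p n x * indicator C x \<partial>histories N n) = (\<integral>\<^sup>+x. q n x * indicator C x \<partial>histories N n)"
    using eq[of n] by (intro nn_integral_cong_AE) auto
  then show "emeasure P E = emeasure Q E"
    unfolding C(2) has_densities_emeasure[OF P C(1)] has_densities_emeasure[OF Q C(1)] .
qed

lemma has_densities_AE_initial: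
  assumes P: "has_densities N P p" and "AE x in density (histories N n) (p n). R x"
  shows "AE \<omega> in P. R (initial n \<omega>)"
proof -
  have "initial n \<in> measurable P (histories N n)"
    using measurable_initial[of n UNIV N] by (simp cong: measurable_cong_sets add: has_densitiesD(2)[OF P])
  then show ?thesis
    using assms(2) unfolding has_densitiesD(5)[OF P, symmetric] by (rule AE_distrD)
qed

lemma has_densities_AE_pos:
  assumes P: "has_densities N P p"
  shows "AE x in density (histories N n) (p n). 0 < p n x"
  by (subst AE_density) (auto simp: has_densitiesD(4)[OF P])

lemma has_densities_AE_finite:
  assumes P: "has_densities N P p"
  shows "AE x in histories N n. p n x < \<infinity>"
proof -
  interpret P: finite_measure P by (rule has_densitiesD(1)[OF P])
  have "(\<integral>\<^sup>+x. p n x \<partial>histories N n) = (\<integral>\<^sup>+x. p n x * indicator (space (histories N n)) x \<partial>histories N n)"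
    by (intro nn_integral_cong) auto
  also have "\<dots> = emeasure P (initial n -` space (histories N n) \<inter> space (outcome_seqs N))"
    by (rule has_densities_emeasure[OF P sets.top, symmetric])
  also have "\<dots> \<noteq> \<infinity>" by simp
  finally have "AE x in histories N n. p n x \<noteq> \<infinity>"
    by (intro nn_integral_PInf_AE has_densitiesD(4)[OF P])
  then show ?thesis
    by eventually_elim (simp add: less_top[symmetric])
qed

text \<open>
  The Ionescu-Tulcea construction adds one outcome at a time, drawn from a kernel with density
  \<open>p n x\<close>; by Tonelli each step multiplies the joint density by that factor.
\<close>

lemma has_densities_seq_dist:
  assumes N: "sigma_finite_measure N" and p: "pred_strategy N p"
  shows "prob_space (seq_dist N p)" "has_densities N (seq_dist N p) (joint_density p)"
proof -
  interpret IT: Ionescu_Tulcea "next_dist N p" "\<lambda>_. N"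
    by (rule pred_strategy_Ionescu_Tulcea[OF N p])
  interpret sigma_finite_measure N by fact
  note [measurable] = measurable_joint_density[OF p]
  have C: "IT.C 0 n (\<lambda>_. undefined) = density (histories N n) (joint_density p n)" for n
  proof (induction n)
    case 0
    interpret product_sigma_finite "\<lambda>_::nat. N" by (intro product_sigma_finite.intro N)
    show ?case
    proof (rule measure_eqI)
      fix A assume "A \<in> sets (IT.C 0 0 (\<lambda>_. undefined))"
      then have "A \<subseteq> {\<lambda>_. undefined}" by (auto dest!: sets.sets_into_space simp: space_PiM)
      then have "A = {} \<or> A = {\<lambda>_. undefined}" by auto
      then show "emeasure (IT.C 0 0 (\<lambda>_. undefined)) A = emeasure (density (histories N 0) (joint_density p 0)) A"
        by (auto simp: PiM_empty emeasure_density)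
    qed simp
  next
    case (Suc n)
    have und: "(\<lambda>_. undefined) \<in> space (histories N 0)" by simp
    show ?case
    proof (rule measure_eqI)
      show sets_eq: "sets (IT.C 0 (Suc n) (\<lambda>_. undefined)) = sets (density (histories N (Suc n)) (joint_density p (Suc n)))"
        using IT.sets_C[OF und, of "Suc n"] by simp
      fix A assume "A \<in> sets (IT.C 0 (Suc n) (\<lambda>_. undefined))"
      with sets_eq have A[measurable]: "A \<in> sets (histories N (Suc n))" by simp
      have ind: "indicator A \<in> borel_measurable (histories N (Suc n))" by measurable
      have eP: "emeasure (IT.eP n x) A = (\<integral>\<^sup>+y. p n x y * indicator A (x(n := y)) \<partial>N)"
        if x: "x \<in> space (histories N n)" for x
      proof -
        have px[measurable]: "p n x \<in> borel_measurable N"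
          using pred_strategy_measurable[OF p measurable_const[OF x] measurable_id] by simp
        have upd[measurable]: "(\<lambda>y. x(n := y)) \<in> measurable N (histories N (Suc n))"
          by (rule measurable_fun_upd[where J="{0..<n}"]) (auto intro: measurable_const x)
        have "emeasure (IT.eP n x) A = (\<integral>\<^sup>+y. indicator A (x(n := y)) \<partial>next_dist N p n x)"
          using IT.nn_integral_eP[OF x, of "indicator A"] ind IT.sets_eP[OF x] A by simp
        also have "\<dots> = (\<integral>\<^sup>+y. p n x y * indicator A (x(n := y)) \<partial>N)"
          unfolding next_dist_def by (subst nn_integral_density) auto
        finally show ?thesis .
      qed
      have eP_m: "(\<lambda>x. emeasure (IT.eP n x) A) \<in> borel_measurable (histories N n)"
        using measurable_emeasure_subprob_algebra[OF A] by (rule measurable_compose[OF IT.measurable_eP])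
      have "emeasure (IT.C 0 (Suc n) (\<lambda>_. undefined)) A =
          emeasure (density (histories N n) (joint_density p n) \<bind> IT.eP n) A"
        by (simp add: Suc.IH)
      also have "\<dots> = (\<integral>\<^sup>+x. emeasure (IT.eP n x) A \<partial>density (histories N n) (joint_density p n))"
      proof (rule emeasure_bind)
        show "space (density (histories N n) (joint_density p n)) \<noteq> {}"
          by (simp add: space_PiM PiE_eq_empty_iff)
        show "IT.eP n \<in> measurable (density (histories N n) (joint_density p n)) (subprob_algebra (histories N (Suc n)))"
          using IT.measurable_eP[of n] by simp
      qed fact
      also have "\<dots> = (\<integral>\<^sup>+x. joint_density p n x * emeasure (IT.eP n x) A \<partial>histories N n)"
        by (rule nn_integral_density) (auto intro: eP_m)
      also have "\<dots> = (\<integral>\<^sup>+x. \<integral>\<^sup>+y. joint_density p (Suc n) (x(n := y)) * indicator A (x(n := y)) \<partial>N \<partial>histories N n)"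
      proof (rule nn_integral_cong)
        fix x assume x: "x \<in> space (histories N n)"
        have [measurable]: "p n x \<in> borel_measurable N"
          using pred_strategy_measurable[OF p measurable_const[OF x] measurable_id] by simp
        have [measurable]: "(\<lambda>y. x(n := y)) \<in> measurable N (histories N (Suc n))"
          by (rule measurable_fun_upd[where J="{0..<n}"]) (auto intro: measurable_const x)
        have "(\<lambda>y. p n x y * indicator A (x(n := y))) \<in> borel_measurable N"
          by measurable
        then show "joint_density p n x * emeasure (IT.eP n x) A =
          (\<integral>\<^sup>+y. joint_density p (Suc n) (x(n := y)) * indicator A (x(n := y)) \<partial>N)"
          unfolding eP[OF x] joint_density_Suc_update[OF x]
          by (subst nn_integral_cmult[symmetric]) (auto simp: mult.assoc)
      qed
      also have "\<dots> = (\<integral>\<^sup>+x. joint_density p (Suc n) x * indicator A x \<partial>histories N (Suc n))"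
        by (rule nn_integral_histories_Suc[OF N, symmetric]) measurable
      also have "\<dots> = emeasure (density (histories N (Suc n)) (joint_density p (Suc n))) A"
        by (rule emeasure_density[symmetric]) auto
      finally show "emeasure (IT.C 0 (Suc n) (\<lambda>_. undefined)) A =
        emeasure (density (histories N (Suc n)) (joint_density p (Suc n))) A" .
    qed
  qed
  have CI: "IT.CI {0..<n} = density (histories N n) (joint_density p n)" for n
  proof (rule measure_eqI)
    show "sets (IT.CI {0..<n}) = sets (density (histories N n) (joint_density p n))"
      using IT.PF.sets_P[of "{0..<n}"] by simp
    fix A assume "A \<in> sets (IT.CI {0..<n})"
    then have A: "A \<in> sets (histories N n)" using IT.PF.sets_P[of "{0..<n}"] by simp
    then show "emeasure (IT.CI {0..<n}) A = emeasure (density (histories N n) (joint_density p n)) A"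
      using IT.emeasure_CI[of "{0..<n}" n A] C[of n] sets.sets_into_space[OF A]
      by (simp add: space_PiM prod_emb_id)
  qed
  have lim: "seq_dist N p = IT.PF.lim" by (simp add: seq_dist_def)
  have sets: "sets (seq_dist N p) = sets (outcome_seqs N)" unfolding lim by simp
  have d: "distr (seq_dist N p) (histories N n) (initial n) = density (histories N n) (joint_density p n)" for n
    unfolding lim using IT.distr_lim[of "{0..<n}"] CI by simp
  show prob: "prob_space (seq_dist N p)"
  proof (rule prob_space_distrD)
    show "initial 0 \<in> measurable (seq_dist N p) (histories N 0)"
      using measurable_initial[of 0 UNIV N] by (simp cong: measurable_cong_sets add: sets)
    show "prob_space (distr (seq_dist N p) (histories N 0) (initial 0))"
      unfolding d CI[symmetric] by (rule IT.PF.prob_space_P) auto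
  qed
  show "has_densities N (seq_dist N p) (joint_density p)"
    unfolding has_densities_def using prob sets d by (auto simp: prob_space_def)
qed

lemma sets_seq_dist[simp]:
  assumes "sigma_finite_measure N" and "pred_strategy N p"
  shows "sets (seq_dist N p) = sets (outcome_seqs N)" "space (seq_dist N p) = space (outcome_seqs N)"
  using has_densitiesD[OF has_densities_seq_dist(2)[OF assms]] by auto

text \<open>
  On cylinders this is Tonelli's theorem for the joint density, and the cylinders generate. There
  will be three kinds of parameters: those of a model, the switching sequences, and the histories on
  which a future depends.
\<close>

lemma measurable_seq_dist:
  assumes N: "sigma_finite_measure N"
    and p: "\<And>\<theta>. \<theta> \<in> space M \<Longrightarrow> pred_strategy N (p \<theta>)"
    and j: "\<And>n. (\<lambda>(\<theta>, x). joint_density (p \<theta>) n x) \<in> borel_measurable (M \<Otimes>\<^sub>M histories N n)"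
  shows "(\<lambda>\<theta>. seq_dist N (p \<theta>)) \<in> measurable M (prob_algebra (outcome_seqs N))"
proof (rule measurable_prob_algebra_generated[OF sets_outcome_seqs_eq_past Int_stable_past])
  show "(\<Union>n. sets (past N n)) \<subseteq> Pow (space (outcome_seqs N))"
    using sets_past_le sets.sets_into_space by blast
  fix \<theta> assume \<theta>: "\<theta> \<in> space M"
  show "prob_space (seq_dist N (p \<theta>))" "sets (seq_dist N (p \<theta>)) = sets (outcome_seqs N)"
    using has_densities_seq_dist(1)[OF N p[OF \<theta>]] N p[OF \<theta>] by auto
next
  fix A assume "A \<in> (\<Union>n. sets (past N n))"
  then obtain n C where C[measurable]: "C \<in> sets (histories N n)" "A = initial n -` C \<inter> space (outcome_seqs N)"
    unfolding sets_past by blast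
  interpret product_sigma_finite "\<lambda>_::nat. N" by (intro product_sigma_finite.intro N)
  interpret H: sigma_finite_measure "histories N n" by (rule sigma_finite) simp
  note [measurable] = j[of n]
  have "(\<lambda>\<theta>. \<integral>\<^sup>+x. joint_density (p \<theta>) n x * indicator C x \<partial>histories N n) \<in> borel_measurable M"
    by measurable
  also have "?this \<longleftrightarrow> (\<lambda>\<theta>. emeasure (seq_dist N (p \<theta>)) A) \<in> borel_measurable M"
    unfolding C(2)
    by (intro measurable_cong has_densities_emeasure[symmetric] has_densities_seq_dist N p C(1))
  finally show "(\<lambda>\<theta>. emeasure (seq_dist N (p \<theta>)) A) \<in> borel_measurable M" .
qed

text \<open>
  Tonelli. With a prior as \<open>\<mu>\<close> this gives the joint density of the Bayesian strategy, with the prior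
  on switching sequences that of the switch distribution.
\<close>

lemma has_densities_mixture:
  assumes N: "sigma_finite_measure N" and \<mu>: "finite_measure \<mu>" and ne: "space \<mu> \<noteq> {}"
    and p: "\<And>\<theta>. \<theta> \<in> space \<mu> \<Longrightarrow> pred_strategy N (p \<theta>)"
    and j: "\<And>n. (\<lambda>(\<theta>, x). joint_density (p \<theta>) n x) \<in> borel_measurable (\<mu> \<Otimes>\<^sub>M histories N n)"
  shows "has_densities N (\<mu> \<bind> (\<lambda>\<theta>. seq_dist N (p \<theta>))) (\<lambda>n x. \<integral>\<^sup>+\<theta>. joint_density (p \<theta>) n x \<partial>\<mu>)"
proof -
  let ?B = "\<mu> \<bind> (\<lambda>\<theta>. seq_dist N (p \<theta>))"
  interpret \<mu>: finite_measure \<mu> by fact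
  have K: "(\<lambda>\<theta>. seq_dist N (p \<theta>)) \<in> measurable \<mu> (subprob_algebra (outcome_seqs N))"
    by (intro measurable_prob_algebraD measurable_seq_dist N p j)
  have sets: "sets ?B = sets (outcome_seqs N)"
    using N p ne by (intro sets_bind) auto
  have em: "emeasure ?B A = (\<integral>\<^sup>+\<theta>. emeasure (seq_dist N (p \<theta>)) A \<partial>\<mu>)" if "A \<in> sets (outcome_seqs N)" for A
    by (rule emeasure_bind[OF ne K that])
  have fin: "finite_measure ?B"
  proof
    have "emeasure ?B (space ?B) = (\<integral>\<^sup>+\<theta>. emeasure (seq_dist N (p \<theta>)) (space ?B) \<partial>\<mu>)"
      using sets by (intro em) (metis sets.top)
    also have "\<dots> \<le> (\<integral>\<^sup>+\<theta>. 1 \<partial>\<mu>)"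
      by (intro nn_integral_mono prob_space.measure_le_1 has_densities_seq_dist N p)
    also have "\<dots> < \<infinity>" by (simp add: less_top[symmetric])
    finally show "emeasure ?B (space ?B) \<noteq> \<infinity>" by simp
  qed
  interpret product_sigma_finite "\<lambda>_::nat. N" by (intro product_sigma_finite.intro N)
  have m: "(\<lambda>x. \<integral>\<^sup>+\<theta>. joint_density (p \<theta>) n x \<partial>\<mu>) \<in> borel_measurable (histories N n)" for n
    using measurable_compose[OF measurable_pair_swap' j[of n]]
    by (intro \<mu>.borel_measurable_nn_integral) (simp add: split_beta')
  have d: "distr ?B (histories N n) (initial n) = density (histories N n) (\<lambda>x. \<integral>\<^sup>+\<theta>. joint_density (p \<theta>) n x \<partial>\<mu>)" for n
  proof (rule measure_eqI)
    fix C assume "C \<in> sets (distr ?B (histories N n) (initial n))"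
    then have C[measurable]: "C \<in> sets (histories N n)" by simp
    interpret H: sigma_finite_measure "histories N n" by (rule sigma_finite) simp
    interpret pair_sigma_finite \<mu> "histories N n" ..
    note [measurable] = j[of n] m[of n]
    have "initial n \<in> measurable ?B (histories N n)"
      using measurable_initial[of n UNIV N] by (simp cong: measurable_cong_sets add: sets)
    then have "emeasure (distr ?B (histories N n) (initial n)) C = emeasure ?B (initial n -` C \<inter> space (outcome_seqs N))"
      using sets_eq_imp_space_eq[OF sets] by (simp add: emeasure_distr)
    also have "\<dots> = (\<integral>\<^sup>+\<theta>. emeasure (seq_dist N (p \<theta>)) (initial n -` C \<inter> space (outcome_seqs N)) \<partial>\<mu>)"
      by (intro em measurable_sets[OF measurable_initial]) auto
    also have "\<dots> = (\<integral>\<^sup>+\<theta>. \<integral>\<^sup>+x. joint_density (p \<theta>) n x * indicator C x \<partial>histories N n \<partial>\<mu>)"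
      by (intro nn_integral_cong has_densities_emeasure has_densities_seq_dist N p C)
    also have "\<dots> = (\<integral>\<^sup>+x. \<integral>\<^sup>+\<theta>. joint_density (p \<theta>) n x * indicator C x \<partial>\<mu> \<partial>histories N n)"
      by (rule Fubini'[symmetric]) measurable
    also have "\<dots> = (\<integral>\<^sup>+x. (\<integral>\<^sup>+\<theta>. joint_density (p \<theta>) n x \<partial>\<mu>) * indicator C x \<partial>histories N n)"
      by (intro nn_integral_cong) (auto split: split_indicator)
    also have "\<dots> = emeasure (density (histories N n) (\<lambda>x. \<integral>\<^sup>+\<theta>. joint_density (p \<theta>) n x \<partial>\<mu>)) C"
      by (rule emeasure_density[symmetric]) auto
    finally show "emeasure (distr ?B (histories N n) (initial n)) C =
      emeasure (density (histories N n) (\<lambda>x. \<integral>\<^sup>+\<theta>. joint_density (p \<theta>) n x \<partial>\<mu>)) C" .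
  qed simp
  show ?thesis unfolding has_densities_def using fin sets m d by blast
qed

section \<open>The Bayesian strategy is the mixture of its model\<close>

text \<open>
  The exceptional set lies in a measurable null set of the mixture, and the measures of that set
  under the components integrate to 0.
\<close>

lemma AE_bind_imp_AE:
  assumes K: "K \<in> measurable M (subprob_algebra L)" and R: "AE \<omega> in M \<bind> K. R \<omega>"
  shows "AE \<theta> in M. AE \<omega> in K \<theta>. R \<omega>"
proof (cases "space M = {}")
  case True
  then show ?thesis by (intro AE_I2) auto
next
  case False
  have sets: "sets (M \<bind> K) = sets L"
    using measurable_space[OF K] False by (intro sets_bind) (auto simp: space_subprob_algebra)
  obtain Z where Z: "Z \<in> sets L" "emeasure (M \<bind> K) Z = 0" "{\<omega>\<in>space (M \<bind> K). \<not> R \<omega>} \<subseteq> Z"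
    using R sets by (elim AE_E) auto
  have "(\<integral>\<^sup>+\<theta>. emeasure (K \<theta>) Z \<partial>M) = 0"
    using Z emeasure_bind[OF False K Z(1)] by simp
  then have "AE \<theta> in M. emeasure (K \<theta>) Z = 0"
    using measurable_compose[OF K measurable_emeasure_subprob_algebra[OF Z(1)]]
    by (subst (asm) nn_integral_0_iff_AE) auto
  then show ?thesis
    using AE_space
  proof eventually_elim
    case (elim \<theta>)
    have K\<theta>: "sets (K \<theta>) = sets L"
      using measurable_space[OF K elim(2)] by (auto simp: space_subprob_algebra)
    show ?case
    proof (rule AE_I[of _ _ Z])
      show "{\<omega> \<in> space (K \<theta>). \<not> R \<omega>} \<subseteq> Z"
        using Z(3) sets_eq_imp_space_eq[OF K\<theta>] sets_eq_imp_space_eq[OF sets] by auto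
    qed (use elim(1) Z(1) K\<theta> in auto)
  qed
qed

lemma space_param_space: "\<Theta> \<in> sets (lebesgue_pow m) \<Longrightarrow> space (param_space m \<Theta>) = \<Theta>"
  by (auto simp: space_restrict_space dest: sets.sets_into_space)

lemma bayes_joint_density_eq_mixture:
  assumes \<Theta>: "parametric_model N m \<Theta> p" and w: "prior_density m \<Theta> w"
    and x: "x \<in> space (histories N n)"
  shows "bayes_joint_density m \<Theta> w p n x = (\<integral>\<^sup>+\<theta>. joint_density (p \<theta>) n x \<partial>prior_measure m \<Theta> w)"
proof -
  have "(\<lambda>(\<theta>, x). joint_density (p \<theta>) n x) \<in> borel_measurable (param_space m \<Theta> \<Otimes>\<^sub>M histories N n)"
    using \<Theta> by (auto simp: parametric_model_def)
  from measurable_compose[OF measurable_Pair2'[OF x] this]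
  have "(\<lambda>\<theta>. joint_density (p \<theta>) n x) \<in> borel_measurable (param_space m \<Theta>)"
    by simp
  then show ?thesis
    using w unfolding bayes_joint_density_def prior_measure_def
    by (subst nn_integral_density) (auto simp: prior_density_def mult.commute)
qed

text \<open>
  The joint density of the Bayesian strategy telescopes to \<open>\<integral> p\<^sub>\<theta>(x\<^sup>n) w(\<theta>) d\<theta>\<close>, except where a
  conditional is not given by the quotient. If the integral vanishes at \<open>x\<^sup>n\<close>, then \<open>p\<^sub>\<theta>(x\<^sup>n) = 0\<close> for
  \<open>w\<close>-almost all \<open>\<theta>\<close> and the integral vanishes at all continuations, so any conditional is correct there;
  and the integral is infinite only on a null set of histories. Thus both laws have almost everywhere
  the same densities and agree.
\<close>

lemma bayes_strategy_mixture:
  assumes N: "sigma_finite_measure N" and model: "parametric_model N m \<Theta> p" and prior: "prior_density m \<Theta> w"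
    and bayes: "bayes_strategy N m \<Theta> w p pbar"
  shows "(\<lambda>\<theta>. seq_dist N (p \<theta>)) \<in> measurable (prior_measure m \<Theta> w) (subprob_algebra (outcome_seqs N))"
    and "seq_dist N pbar = prior_measure m \<Theta> w \<bind> (\<lambda>\<theta>. seq_dist N (p \<theta>))"
proof -
  let ?\<mu> = "prior_measure m \<Theta> w" and ?b = "bayes_joint_density m \<Theta> w p"
  have wm: "w \<in> borel_measurable (param_space m \<Theta>)" and w1: "(\<integral>\<^sup>+\<theta>. w \<theta> \<partial>param_space m \<Theta>) = 1"
    using prior by (auto simp: prior_density_def)
  have sp: "space ?\<mu> = \<Theta>"
    using model space_param_space by (auto simp: prior_measure_def parametric_model_def)
  have \<mu>1: "emeasure ?\<mu> (space ?\<mu>) = 1"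
    using wm w1 by (simp add: prior_measure_def emeasure_density cong: nn_integral_cong)
  then interpret \<mu>: prob_space ?\<mu> by (rule prob_spaceI)
  have p: "pred_strategy N (p \<theta>)" if "\<theta> \<in> space ?\<mu>" for \<theta>
    using model that sp by (auto simp: parametric_model_def)
  have j: "(\<lambda>(\<theta>, x). joint_density (p \<theta>) n x) \<in> borel_measurable (?\<mu> \<Otimes>\<^sub>M histories N n)" for n
    using model by (auto simp: parametric_model_def prior_measure_def cong: measurable_cong_sets)
  have pbar: "pred_strategy N pbar" using bayes by (auto simp: bayes_strategy_def)
  show K: "(\<lambda>\<theta>. seq_dist N (p \<theta>)) \<in> measurable ?\<mu> (subprob_algebra (outcome_seqs N))"
    by (intro measurable_prob_algebraD measurable_seq_dist N p j)
  have mix: "has_densities N (?\<mu> \<bind> (\<lambda>\<theta>. seq_dist N (p \<theta>))) (\<lambda>n x. \<integral>\<^sup>+\<theta>. joint_density (p \<theta>) n x \<partial>?\<mu>)"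
    by (rule has_densities_mixture[OF N \<mu>.finite_measure_axioms \<mu>.not_empty p j])
  have b_eq: "?b n x = (\<integral>\<^sup>+\<theta>. joint_density (p \<theta>) n x \<partial>?\<mu>)" if "x \<in> space (histories N n)" for n x
    by (rule bayes_joint_density_eq_mixture[OF model prior that])
  have b_meas: "?b n \<in> borel_measurable (histories N n)" for n
    using has_densitiesD(4)[OF mix] by (subst measurable_cong[OF b_eq])
  have b_fin: "AE x in histories N n. ?b n x < \<infinity>" for n
    using has_densities_AE_finite[OF mix, of n] by (rule AE_mp) (auto intro!: AE_I2 simp: b_eq)
  have eq: "AE x in histories N n. joint_density pbar n x = ?b n x" for n
  proof (induction n)
    case 0
    show ?case
      using \<mu>.emeasure_space_1 by (intro AE_I2) (simp add: b_eq)
  next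
    case (Suc n)
    \<comment> \<open>In \<open>[0, \<infinity>]\<close> a zero factor absorbs an infinite conditional density.\<close>
    have b0: "?b (Suc n) (x(n := y)) = 0" if x: "x \<in> space (histories N n)" and y: "y \<in> space N" and 0: "?b n x = 0" for x y
    proof -
      have jm: "(\<lambda>\<theta>. joint_density (p \<theta>) n x) \<in> borel_measurable ?\<mu>"
        using measurable_compose[OF measurable_Pair2'[OF x] j] by simp
      have "AE \<theta> in ?\<mu>. joint_density (p \<theta>) n x = 0"
        using 0 nn_integral_0_iff_AE[OF jm] by (simp add: b_eq[OF x])
      then have "(\<integral>\<^sup>+\<theta>. joint_density (p \<theta>) (Suc n) (x(n := y)) \<partial>?\<mu>) = (\<integral>\<^sup>+\<theta>. 0 \<partial>?\<mu>)"
        by (intro nn_integral_cong_AE) (auto simp: joint_density_Suc_update[OF x])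
      then show ?thesis
        using histories_Suc_update[OF x y] by (simp add: b_eq)
    qed
    have step: "joint_density pbar (Suc n) (x(n := y)) = ?b (Suc n) (x(n := y))"
      if x: "x \<in> space (histories N n)" and y: "y \<in> space N"
        and IH: "joint_density pbar n x = ?b n x" and fin: "?b n x < \<infinity>" for x y
    proof (cases "?b n x = 0")
      case True
      then show ?thesis using b0[OF x y True] IH by (simp add: joint_density_Suc_update[OF x])
    next
      case False
      then have "pbar n x y = ?b (Suc n) (x(n := y)) / ?b n x"
        using bayes x y fin by (auto simp: bayes_strategy_def zero_less_iff_neq_zero)
      then have "joint_density pbar (Suc n) (x(n := y)) = ?b n x * (?b (Suc n) (x(n := y)) / ?b n x)"
        using IH by (simp add: joint_density_Suc_update[OF x])
      also have "\<dots> = ?b (Suc n) (x(n := y))"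
        using False fin by (simp add: ennreal_times_divide ennreal_mult_divide_eq mult.commute[of "?b n x"])
      finally show ?thesis .
    qed
    let ?f = "\<lambda>x. indicator {x \<in> space (histories N (Suc n)). joint_density pbar (Suc n) x \<noteq> ?b (Suc n) x} x :: ennreal"
    have m: "{x \<in> space (histories N (Suc n)). joint_density pbar (Suc n) x \<noteq> ?b (Suc n) x} \<in> sets (histories N (Suc n))"
      by (intro borel_measurable_neq measurable_joint_density[OF pbar] b_meas)
    have "emeasure (histories N (Suc n)) {x \<in> space (histories N (Suc n)). joint_density pbar (Suc n) x \<noteq> ?b (Suc n) x}
       = (\<integral>\<^sup>+x. ?f x \<partial>histories N (Suc n))"
      using m by simp
    also have "\<dots> = (\<integral>\<^sup>+x. \<integral>\<^sup>+y. ?f (x(n := y)) \<partial>N \<partial>histories N n)"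
      using m by (intro nn_integral_histories_Suc[OF N]) auto
    also have "\<dots> = (\<integral>\<^sup>+x. 0 \<partial>histories N n)"
      using Suc.IH b_fin[of n] AE_space[of "histories N n"]
    proof (intro nn_integral_cong_AE, eventually_elim)
      case (elim x)
      have "(\<integral>\<^sup>+y. ?f (x(n := y)) \<partial>N) = (\<integral>\<^sup>+y. 0 \<partial>N)"
        using elim by (intro nn_integral_cong) (auto simp: step)
      then show ?case by simp
    qed
    finally have "{x \<in> space (histories N (Suc n)). joint_density pbar (Suc n) x \<noteq> ?b (Suc n) x} \<in> null_sets (histories N (Suc n))"
      using m by auto
    then show ?case by (rule AE_I') auto
  qed
  have "AE x in histories N n. joint_density pbar n x = (\<integral>\<^sup>+\<theta>. joint_density (p \<theta>) n x \<partial>?\<mu>)" for n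
    using eq[of n] by (rule AE_mp) (auto intro!: AE_I2 simp: b_eq)
  then show "seq_dist N pbar = ?\<mu> \<bind> (\<lambda>\<theta>. seq_dist N (p \<theta>))"
    by (rule has_densities_unique[OF has_densities_seq_dist(2)[OF N pbar] mix])
qed

section \<open>Disintegration along a history\<close>

lemma pred_strategy_future:
  assumes p: "pred_strategy N p" and x: "x \<in> space (histories N n)"
  shows "pred_strategy N (future_strategy p n x)"
  unfolding pred_strategy_def
proof (intro allI conjI ballI)
  fix i
  have c: "(\<lambda>z. initial (n + i) (comb_seq n x z)) \<in> measurable (histories N i) (histories N (n + i))"
    using measurable_compose[OF measurable_Pair1'[OF x] measurable_comb_initial[of i "{0..<i}" n N]]
    by (simp del: restrict_apply)
  show "(\<lambda>(z, y). future_strategy p n x i z y) \<in> borel_measurable (histories N i \<Otimes>\<^sub>M N)"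
    unfolding future_strategy_def split_beta'
    by (intro pred_strategy_measurable[OF p] measurable_compose[OF measurable_fst c] measurable_snd)
  fix z assume "z \<in> space (histories N i)"
  from measurable_space[OF c this] show "prob_space (next_dist N (future_strategy p n x) i z)"
    using p by (simp add: pred_strategy_def next_dist_def future_strategy_def del: restrict_apply)
qed

text \<open>
  Both sides agree on all cylinders: the joint density of \<open>n + i\<close> outcomes is the product of that of
  the first \<open>n\<close> and that of the future strategy. A cylinder decided before time \<open>n\<close> is treated as one
  decided at time \<open>n + i\<close>.
\<close>

lemma seq_dist_eq_bind_future:
  fixes n :: nat
  assumes N: "sigma_finite_measure N" and p: "pred_strategy N p"
  defines "K \<equiv> \<lambda>x. distr (future_dist N p n x) (outcome_seqs N) (comb_seq n x)"
  shows "K \<in> measurable (density (histories N n) (joint_density p n)) (subprob_algebra (outcome_seqs N))"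
    and "seq_dist N p = density (histories N n) (joint_density p n) \<bind> K"
proof -
  let ?H = "density (histories N n) (joint_density p n)"
  interpret product_sigma_finite "\<lambda>_::nat. N" by (intro product_sigma_finite.intro N)
  note P = has_densities_seq_dist[OF N p]
  have fut: "pred_strategy N (future_strategy p n x)" if "x \<in> space (histories N n)" for x
    by (rule pred_strategy_future[OF p that])
  have j: "(\<lambda>(x, z). joint_density (future_strategy p n x) i z) \<in> borel_measurable (histories N n \<Otimes>\<^sub>M histories N i)" for i
  proof -
    have ci: "(\<lambda>x. initial (n + k) (comb_seq n (fst x) (snd x))) \<in>
        measurable (histories N n \<Otimes>\<^sub>M histories N i) (histories N (n + k))" if "k < i" for k
      using measurable_comb_initial[of k "{0..<i}" n N] that by (simp add: split_beta' del: restrict_apply)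
    show ?thesis
      unfolding joint_density_def future_strategy_def split_beta' initial_comb_initial
      by (intro borel_measurable_prod_ennreal pred_strategy_measurable[OF p] ci
          measurable_compose[OF measurable_snd] measurable_component_singleton) auto
  qed
  have fK: "(\<lambda>x. future_dist N p n x) \<in> measurable (histories N n) (subprob_algebra (outcome_seqs N))"
    unfolding future_dist_def by (intro measurable_prob_algebraD measurable_seq_dist N fut j)
  show K: "K \<in> measurable ?H (subprob_algebra (outcome_seqs N))"
    unfolding K_def using measurable_distr2[OF measurable_comb[of n N] fK] by (simp cong: measurable_cong_sets)
  have Hne: "space ?H \<noteq> {}"
  proof -
    have "prob_space ?H"
      unfolding has_densitiesD(5)[OF P(2), symmetric]
      using measurable_initial[of n UNIV N]
      by (intro prob_space.prob_space_distr P(1)) (simp cong: measurable_cong_sets add: N p)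
    then show ?thesis by (rule prob_space.not_empty)
  qed
  show "seq_dist N p = ?H \<bind> K"
  proof (rule measure_eqI_past)
    show "finite_measure (seq_dist N p)" "sets (seq_dist N p) = sets (outcome_seqs N)"
      using has_densitiesD[OF P(2)] by auto
    show "sets (?H \<bind> K) = sets (outcome_seqs N)"
      using Hne by (intro sets_bind) (auto simp: K_def)
    fix i E assume "E \<in> sets (past N i)"
    \<comment> \<open>The joint density splits at time \<open>n\<close>, so the cylinder must extend beyond it.\<close>
    then have "E \<in> sets (past N (n + i))" using past_mono[of i "n + i" N] by auto
    then obtain C where C[measurable]: "C \<in> sets (histories N (n + i))" and E: "E = initial (n + i) -` C \<inter> space (outcome_seqs N)"
      unfolding sets_past by auto
    have E_sets: "E \<in> sets (outcome_seqs N)" unfolding E by auto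
    have "emeasure (?H \<bind> K) E = (\<integral>\<^sup>+x. emeasure (K x) E \<partial>?H)"
      by (rule emeasure_bind[OF Hne K E_sets])
    also have "\<dots> = (\<integral>\<^sup>+x. joint_density p n x * emeasure (K x) E \<partial>histories N n)"
      using measurable_compose[OF K measurable_emeasure_subprob_algebra[OF E_sets]]
      by (intro nn_integral_density measurable_joint_density[OF p]) simp
    also have "\<dots> = (\<integral>\<^sup>+x. \<integral>\<^sup>+z. joint_density p (n + i) (initial (n + i) (comb_seq n x z)) *
        indicator C (initial (n + i) (comb_seq n x z)) \<partial>histories N i \<partial>histories N n)"
    proof (rule nn_integral_cong)
      fix x assume x: "x \<in> space (histories N n)"
      have cx: "comb_seq n x \<in> measurable (outcome_seqs N) (outcome_seqs N)"
        using measurable_compose[OF measurable_Pair1'[OF x] measurable_comb] by simp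
      have ci: "(\<lambda>z. initial (n + i) (comb_seq n x z)) \<in> measurable (histories N i) (histories N (n + i))"
        using measurable_compose[OF measurable_Pair1'[OF x] measurable_comb_initial[of i "{0..<i}" n N]]
        by (simp del: restrict_apply)
      let ?C = "(\<lambda>z. initial (n + i) (comb_seq n x z)) -` C \<inter> space (histories N i)"
      have C': "?C \<in> sets (histories N i)" by (rule measurable_sets[OF ci C])
      note F = has_densities_seq_dist(2)[OF N fut[OF x]]
      have "emeasure (K x) E = emeasure (future_dist N p n x) (comb_seq n x -` E \<inter> space (outcome_seqs N))"
        unfolding K_def using cx E_sets N fut[OF x]
        by (subst emeasure_distr) (simp_all add: future_dist_def cong: measurable_cong_sets)
      also have "comb_seq n x -` E \<inter> space (outcome_seqs N) = initial i -` ?C \<inter> space (outcome_seqs N)"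
        using measurable_space[OF cx] measurable_space[OF measurable_initial[of i UNIV N]]
        unfolding E by (auto simp: initial_comb_initial simp del: restrict_apply)
      also have "emeasure (future_dist N p n x) \<dots> = (\<integral>\<^sup>+z. joint_density (future_strategy p n x) i z * indicator ?C z \<partial>histories N i)"
        unfolding future_dist_def by (rule has_densities_emeasure[OF F C'])
      finally have "joint_density p n x * emeasure (K x) E =
          joint_density p n x * (\<integral>\<^sup>+z. joint_density (future_strategy p n x) i z * indicator ?C z \<partial>histories N i)"
        by simp
      also have "\<dots> = (\<integral>\<^sup>+z. joint_density p n x * (joint_density (future_strategy p n x) i z * indicator ?C z) \<partial>histories N i)"
        by (intro nn_integral_cmult[symmetric] borel_measurable_times_ennreal has_densitiesD(4)[OF F]
            borel_measurable_indicator C')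
      also have "\<dots> = (\<integral>\<^sup>+z. joint_density p (n + i) (initial (n + i) (comb_seq n x z)) *
        indicator C (initial (n + i) (comb_seq n x z)) \<partial>histories N i)"
      proof (rule nn_integral_cong)
        fix z assume "z \<in> space (histories N i)"
        then have "indicator ?C z = (indicator C (initial (n + i) (comb_seq n x z)) :: ennreal)"
          by (simp add: indicator_def del: restrict_apply)
        then show "joint_density p n x * (joint_density (future_strategy p n x) i z * indicator ?C z) =
            joint_density p (n + i) (initial (n + i) (comb_seq n x z)) * indicator C (initial (n + i) (comb_seq n x z))"
          by (simp only: joint_density_initial joint_density_comb mult.assoc)
      qed
      finally show "joint_density p n x * emeasure (K x) E = \<dots>" .
    qed
    also have "\<dots> = (\<integral>\<^sup>+x. joint_density p (n + i) x * indicator C x \<partial>histories N (n + i))"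
      by (intro nn_integral_histories_add[OF N, symmetric] borel_measurable_times_ennreal
          measurable_joint_density[OF p] borel_measurable_indicator C)
    also have "\<dots> = emeasure (seq_dist N p) E"
      unfolding E by (rule has_densities_emeasure[OF P(2) C, symmetric])
    finally show "emeasure (seq_dist N p) E = emeasure (?H \<bind> K) E" by simp
  qed
qed

lemma AE_seq_dist_future:
  assumes N: "sigma_finite_measure N" and p: "pred_strategy N p"
    and R: "Measurable.pred (outcome_seqs N) R"
    and AE: "AE x in density (histories N n) (joint_density p n). AE z in future_dist N p n x. R (comb_seq n x z)"
  shows "AE \<omega> in seq_dist N p. R \<omega>"
proof -
  note K = seq_dist_eq_bind_future[OF N p, of n]
  have "AE x in density (histories N n) (joint_density p n).
      AE \<omega> in distr (future_dist N p n x) (outcome_seqs N) (comb_seq n x). R \<omega>"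
    using AE AE_space
  proof eventually_elim
    case (elim x)
    then have x: "x \<in> space (histories N n)" by simp
    have cx: "comb_seq n x \<in> measurable (future_dist N p n x) (outcome_seqs N)"
      using measurable_compose[OF measurable_Pair1'[OF x] measurable_comb] pred_strategy_future[OF p x] N
      by (simp add: future_dist_def cong: measurable_cong_sets)
    show ?case using elim R by (subst AE_distr_iff[OF cx]) (auto simp: pred_def)
  qed
  then show ?thesis
    unfolding K(2) by (subst AE_bind[OF K(1) R])
qed

section \<open>Singularity of the switching laws\<close>

text \<open>
  Events that separate the futures after \<open>x\<^sup>n\<close> depend on \<open>x\<^sup>n\<close>, and nothing says that they can be
  chosen measurably. The likelihood ratio provides the choice: after every history the ratio of the
  future densities vanishes almost surely. The full ratio differs from it by the factor
  \<open>q(x\<^sup>n) / p(x\<^sup>n)\<close>, which is almost surely finite, so it vanishes too, and the laws are singular.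
\<close>

lemma singular_futures_imp_singular:
  assumes N: "sigma_finite_measure N" and p: "pred_strategy N p" and q: "pred_strategy N q"
    and sing: "\<And>x. x \<in> space (histories N n) \<Longrightarrow> mutually_singular (future_dist N p n x) (future_dist N q n x)"
  shows "mutually_singular (seq_dist N p) (seq_dist N q)"
proof (rule ratio_vanishes_imp_singular[where N=N])
  show P: "has_densities N (seq_dist N p) (joint_density p)" and Q: "has_densities N (seq_dist N q) (joint_density q)"
    by (intro has_densities_seq_dist N p q)+
  have "AE x in density (histories N n) (joint_density p n). joint_density q n x < \<infinity>"
    using has_densities_AE_finite[OF Q, of n]
    by (subst AE_density) (auto simp: measurable_joint_density[OF p])
  with has_densities_AE_pos[OF P, of n] AE_space
  have "AE x in density (histories N n) (joint_density p n). AE z in future_dist N p n x.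
      ratio_vanishes (joint_density q) (joint_density p) (comb_seq n x z)"
  proof eventually_elim
    case (elim x)
    let ?a = "joint_density p n x" and ?b = "joint_density q n x"
    have x: "x \<in> space (histories N n)" using elim by simp
    have "AE z in future_dist N p n x.
        ratio_vanishes (joint_density (future_strategy q n x)) (joint_density (future_strategy p n x)) z"
      using sing[OF x] unfolding future_dist_def
      by (rule singular_imp_ratio_vanishes[OF has_densities_seq_dist(2)[OF N pred_strategy_future[OF p x]]
            has_densities_seq_dist(2)[OF N pred_strategy_future[OF q x]]])
    then show ?case
    proof eventually_elim
      case (elim z)
      show ?case unfolding ratio_vanishes_def
      proof
        fix M :: nat
        \<comment> \<open>\<open>M'\<close> absorbs the ratio \<open>?b / ?a\<close> that the common history contributes.\<close>
        obtain M' :: nat where M': "of_nat M * ?b \<le> ?a * of_nat M'"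
        proof (cases "?a = \<infinity>")
          case True
          then show ?thesis by (intro that[of 1]) simp
        next
          case False
          with \<open>0 < ?a\<close> obtain a where a: "?a = ennreal a" "0 < a"
            by (cases ?a) auto
          from \<open>?b < \<infinity>\<close> obtain b where b: "?b = ennreal b" "0 \<le> b"
            by (cases ?b) auto
          from reals_Archimedean3[OF a(2)] obtain M' where "real M * b < real M' * a" by blast
          then have "ennreal (real M * b) \<le> ennreal (a * real M')"
            by (intro ennreal_leI) (simp add: mult.commute)
          then show ?thesis
            using a b by (intro that[of M']) (simp add: ennreal_of_nat_eq_real_of_nat ennreal_mult)
        qed
        have "\<forall>\<^sub>F i in sequentially. of_nat M * joint_density q (i + n) (initial (i + n) (comb_seq n x z))
            \<le> joint_density p (i + n) (initial (i + n) (comb_seq n x z))"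
          using elim[unfolded ratio_vanishes_def, THEN spec, of M']
        proof eventually_elim
          case (elim i)
          let ?p = "joint_density (future_strategy p n x) i z" and ?q = "joint_density (future_strategy q n x) i z"
          have le: "of_nat M' * ?q \<le> ?p" using elim by (simp only: joint_density_initial)
          have "of_nat M * (?b * ?q) = (of_nat M * ?b) * ?q" by (simp add: mult.assoc)
          also have "\<dots> \<le> (?a * of_nat M') * ?q" using M' by (rule mult_right_mono) simp
          also have "\<dots> = ?a * (of_nat M' * ?q)" by (simp add: mult.assoc)
          also have "\<dots> \<le> ?a * ?p" using le by (rule mult_left_mono) simp
          finally show ?case
            by (simp only: joint_density_initial add.commute[of i n] joint_density_comb)
        qed
        then show "\<forall>\<^sub>F m in sequentially. of_nat M * joint_density q m (initial m (comb_seq n x z))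
            \<le> joint_density p m (initial m (comb_seq n x z))"
          by (rule eventually_sequentially_seg[THEN iffD1])
      qed
    qed
  qed
  then show "AE \<omega> in seq_dist N p. ratio_vanishes (joint_density q) (joint_density p) \<omega>"
    by (intro AE_seq_dist_future[OF N p] measurable_ratio_vanishes[OF P Q])
qed

text \<open>
  The union of the countably many \<open>P\<close>-null sets that carry the components is \<open>P\<close>-null and carries the
  mixture.
\<close>

lemma mutually_singular_bind:
  assumes A: "countable A" and ne: "space \<mu> \<noteq> {}" and K: "K \<in> measurable \<mu> (subprob_algebra L)"
    and "sets P = sets L"
    and AE: "AE s in \<mu>. s \<in> A" and sing: "\<And>s. s \<in> A \<Longrightarrow> mutually_singular P (K s)"
  shows "mutually_singular P (\<mu> \<bind> K)"
proof -
  have sP: "sets P = sets L" "space P = space L" using assms(4) sets_eq_imp_space_eq by auto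
  have sK: "sets (K s) = sets L" "space (K s) = space L" if "s \<in> A" for s
    using sing[OF that] assms(4) sets_eq_imp_space_eq by (auto simp: mutually_singular_def)
  have sB: "sets (\<mu> \<bind> K) = sets L" "space (\<mu> \<bind> K) = space L"
  proof -
    show "sets (\<mu> \<bind> K) = sets L"
      using measurable_space[OF K] ne by (intro sets_bind) (auto simp: space_subprob_algebra)
    then show "space (\<mu> \<bind> K) = space L" by (rule sets_eq_imp_space_eq)
  qed
  have "\<forall>s\<in>A. \<exists>Z. Z \<in> sets L \<and> emeasure P Z = 0 \<and> emeasure (K s) (space L - Z) = 0"
    using sing sP sK unfolding mutually_singular_def by metis
  then obtain Z where Z: "\<And>s. s \<in> A \<Longrightarrow> Z s \<in> sets L" "\<And>s. s \<in> A \<Longrightarrow> emeasure P (Z s) = 0"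
      "\<And>s. s \<in> A \<Longrightarrow> emeasure (K s) (space L - Z s) = 0"
    by metis
  define B where "B = (\<Union>s\<in>A. Z s)"
  have B: "B \<in> sets L" unfolding B_def using A Z(1) by (intro sets.countable_UN') auto
  have "B \<in> null_sets P"
    unfolding B_def using A Z sP by (intro null_sets_UN') (auto simp: null_sets_def)
  moreover have "emeasure (\<mu> \<bind> K) (space L - B) = 0"
  proof -
    have "emeasure (\<mu> \<bind> K) (space L - B) = (\<integral>\<^sup>+s. emeasure (K s) (space L - B) \<partial>\<mu>)"
      using B by (intro emeasure_bind[OF ne K]) auto
    also have "\<dots> = (\<integral>\<^sup>+s. 0 \<partial>\<mu>)"
    proof (rule nn_integral_cong_AE)
      show "AE s in \<mu>. emeasure (K s) (space L - B) = 0"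
        using AE
      proof eventually_elim
        case (elim s)
        have "emeasure (K s) (space L - B) \<le> emeasure (K s) (space L - Z s)"
          using Z(1)[OF elim] sK[OF elim] elim by (intro emeasure_mono) (auto simp: B_def)
        then show ?case using Z(3)[OF elim] by simp
      qed
    qed
    finally show ?thesis by simp
  qed
  ultimately show ?thesis
    unfolding mutually_singular_def using sP sB B by (intro conjI bexI[of _ B]) auto
qed

section \<open>Forgetting the switches that are still to come\<close>

lemma switch_index_eqI:
  assumes "s \<in> switch_seqs" "i < length s" "fst (s ! i) \<le> n" "Suc i = length s \<or> n < fst (s ! Suc i)"
  shows "switch_index s n = snd (s ! i)"
  unfolding switch_index_def
  using the1_equality[OF switch_index_unique[OF assms(1), of n], of i] assms(2-4) by simp

lemma switch_index_cases:
  assumes "s \<in> switch_seqs"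
  obtains i where "i < length s" "fst (s ! i) \<le> n" "Suc i = length s \<or> n < fst (s ! Suc i)"
    "switch_index s n = snd (s ! i)"
  using switch_index_unique[OF assms, of n] switch_index_eqI[OF assms] by blast

lemma switch_index_pos:
  assumes s: "s \<in> switch_seqs"
  shows "0 < switch_index s n"
proof (rule switch_index_cases[OF s, of n])
  fix i assume i: "i < length s" "switch_index s n = snd (s ! i)"
  have "\<forall>(t, k)\<in>set s. 0 < k" using s by (simp add: switch_seqs_def)
  with nth_mem[OF i(1)] i(2) show ?thesis by (auto simp: split_beta)
qed

lemma switch_index_after_last:
  assumes s: "s \<in> switch_seqs" and n: "fst (last s) \<le> n"
  shows "switch_index s n = snd (last s)"
proof -
  have "s \<noteq> []" using s by (simp add: switch_seqs_def)
  then show ?thesis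
    using n switch_index_eqI[OF s, of "length s - 1" n] by (simp add: last_conv_nth)
qed

definition switches_until :: "nat \<Rightarrow> (nat \<times> nat) list \<Rightarrow> (nat \<times> nat) list" where
  "switches_until n s = takeWhile (\<lambda>(t, k). t \<le> n) s"

text \<open>
  Truncation at time \<open>n\<close> keeps the strategies used up to the prediction of outcome \<open>n + 1\<close>, and the
  last strategy of the truncated sequence is the one used for that prediction. This turns a condition
  on \<open>K\<^sub>n\<^sub>+\<^sub>1\<close> into a condition on the last entry, which no longer depends on \<open>n\<close>.
\<close>

lemma switches_until:
  assumes s: "s \<in> switch_seqs"
  shows "switches_until n s \<in> switch_seqs"
    and "\<And>j. j \<le> n \<Longrightarrow> switch_index (switches_until n s) j = switch_index s j"
    and "switch_index s n = snd (last (switches_until n s))"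
    and "s = switches_until n s \<or> s \<in> switch_extensions (switches_until n s)"
proof -
  let ?u = "switches_until n s"
  have s': "s \<noteq> []" "fst (s ! 0) = 0" "sorted_wrt (<) (map fst s)" "\<forall>(t, k)\<in>set s. 0 < k"
    using s by (auto simp: switch_seqs_def)
  have ne: "?u \<noteq> []" using s'(1,2) by (cases s) (auto simp: switches_until_def)
  have le: "length ?u \<le> length s" by (simp add: switches_until_def length_takeWhile_le)
  have nth: "?u ! i = s ! i" if "i < length ?u" for i
    using that by (simp add: switches_until_def takeWhile_nth)
  have next_gt: "n < fst (s ! length ?u)" if "length ?u < length s"
    using nth_length_takeWhile[of "\<lambda>(t, k). t \<le> n" s] that by (auto simp: switches_until_def split_beta)
  have bound: "fst (?u ! i) \<le> n" if "i < length ?u" for i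
    using set_takeWhileD[of "?u ! i" "\<lambda>(t, k). t \<le> n" s] nth_mem[OF that]
    by (auto simp: switches_until_def split_beta)
  have srt: "sorted_wrt (<) (map fst ?u)"
  proof -
    have "map fst s = map fst ?u @ map fst (dropWhile (\<lambda>(t, k). t \<le> n) s)"
      unfolding map_append[symmetric] switches_until_def by simp
    with s'(3) show ?thesis by (simp only: sorted_wrt_append)
  qed
  show u: "?u \<in> switch_seqs"
    using ne nth[of 0] s'(2,4) srt set_takeWhileD[of _ "\<lambda>(t, k). t \<le> n" s]
    unfolding switch_seqs_def by (auto simp: switches_until_def split_beta)
  show "switch_index ?u j = switch_index s j" if j: "j \<le> n" for j
  proof (rule switch_index_cases[OF u, of j])
    fix i assume i: "i < length ?u" "fst (?u ! i) \<le> j" "Suc i = length ?u \<or> j < fst (?u ! Suc i)"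
      "switch_index ?u j = snd (?u ! i)"
    have "Suc i = length s \<or> j < fst (s ! Suc i)"
    proof (cases "Suc i = length ?u")
      case True
      then show ?thesis using next_gt le j by (metis le_neq_implies_less order_le_less_trans)
    next
      case False
      then show ?thesis using i nth[of "Suc i"] by auto
    qed
    then have "switch_index s j = snd (s ! i)"
      using i(1,2) le nth[OF i(1)] by (intro switch_index_eqI[OF s]) auto
    then show ?thesis using i(4) nth[OF i(1)] by simp
  qed
  from this[of n] show "switch_index s n = snd (last ?u)"
    using switch_index_after_last[OF u, of n] bound[of "length ?u - 1"] ne by (simp add: last_conv_nth)
  show "s = ?u \<or> s \<in> switch_extensions ?u"
  proof (cases "length ?u = length s")
    case True
    then show ?thesis using nth by (auto intro: nth_equalityI)
  next
    case False
    then show ?thesis using le nth s by (auto simp: switch_extensions_def)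
  qed
qed

lemma joint_density_switches_until:
  assumes "s \<in> switch_seqs"
  shows "joint_density (switch_strategy pbar (switches_until n s)) n x = joint_density (switch_strategy pbar s) n x"
  using switches_until(2)[OF assms, of _ n]
  unfolding joint_density_def switch_strategy_def by (intro prod.cong) auto

lemma pred_strategy_switch:
  assumes "\<And>k. 0 < k \<Longrightarrow> pred_strategy N (pbar k)" "s \<in> switch_seqs"
  shows "pred_strategy N (switch_strategy pbar s)"
  unfolding pred_strategy_def
proof
  fix n
  have "switch_strategy pbar s n = pbar (switch_index s n) n"
    by (simp add: switch_strategy_def fun_eq_iff)
  moreover have "pred_strategy N (pbar (switch_index s n))"
    using assms switch_index_pos by blast
  ultimately show "(\<lambda>(x, y). switch_strategy pbar s n x y) \<in> borel_measurable (histories N n \<Otimes>\<^sub>M N) \<and>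
     (\<forall>x\<in>space (histories N n). prob_space (next_dist N (switch_strategy pbar s) n x))"
    by (simp add: pred_strategy_def next_dist_def)
qed

lemma future_switch_after_last:
  assumes "s \<in> switch_seqs" "fst (last s) \<le> n"
  shows "future_strategy (switch_strategy pbar s) n x = future_strategy (pbar (snd (last s))) n x"
  using switch_index_after_last[OF assms(1)] assms(2)
  by (auto simp: future_strategy_def switch_strategy_def fun_eq_iff)

lemma singleton_switch_seqs: "0 < k \<Longrightarrow> [(0, k)] \<in> switch_seqs"
  by (simp add: switch_seqs_def)

lemma switch_strategy_singleton: "0 < k \<Longrightarrow> switch_strategy pbar [(0, k)] = pbar k"
  using switch_index_after_last[OF singleton_switch_seqs] by (simp add: switch_strategy_def fun_eq_iff)

lemma nn_integral_switch_prior: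
  assumes "set_pmf \<pi> \<subseteq> switch_seqs"
  shows "(\<integral>\<^sup>+s. f s * ennreal (pmf \<pi> s) \<partial>count_space {s \<in> switch_seqs. R s}) = (\<integral>\<^sup>+s. f s * indicator {s. R s} s \<partial>measure_pmf \<pi>)"
proof -
  have "(\<integral>\<^sup>+s. f s * ennreal (pmf \<pi> s) \<partial>count_space {s \<in> switch_seqs. R s}) =
      (\<integral>\<^sup>+s. f s * ennreal (pmf \<pi> s) * indicator {s \<in> switch_seqs. R s} s \<partial>count_space UNIV)"
    by (subst nn_integral_count_space_indicator) auto
  also have "\<dots> = (\<integral>\<^sup>+s. ennreal (pmf \<pi> s) * (f s * indicator {s. R s} s) \<partial>count_space UNIV)"
    using assms by (intro nn_integral_cong) (auto simp: indicator_def mult.commute set_pmf_iff)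
  finally show ?thesis by (simp add: nn_integral_measure_pmf)
qed

text \<open>
  Everything that is truncated to \<open>s\<close> is either \<open>s\<close> or a proper extension of \<open>s\<close>. Here the bound on
  the prior mass of the extensions enters.
\<close>

lemma pmf_switches_until_le:
  assumes support: "set_pmf \<pi> \<subseteq> switch_seqs" and c: "0 < c"
    and ext: "\<And>s. s \<in> switch_seqs \<Longrightarrow> measure_pmf.prob \<pi> (switch_extensions s) \<le> c * pmf \<pi> s"
  shows "pmf (map_pmf (switches_until n) \<pi>) s \<le> (1 + c) * pmf \<pi> s"
proof (cases "s \<in> switch_seqs")
  case True
  have "pmf (map_pmf (switches_until n) \<pi>) s = measure_pmf.prob \<pi> (switches_until n -` {s})"
    by (rule pmf_map)
  also have "\<dots> \<le> measure_pmf.prob \<pi> ({s} \<union> switch_extensions s)"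
  proof (rule measure_pmf.finite_measure_mono_AE)
    show "AE s' in measure_pmf \<pi>. s' \<in> switches_until n -` {s} \<longrightarrow> s' \<in> {s} \<union> switch_extensions s"
      using support switches_until(4)[of _ n] by (auto simp: AE_measure_pmf_iff)
  qed simp
  also have "\<dots> \<le> measure_pmf.prob \<pi> {s} + measure_pmf.prob \<pi> (switch_extensions s)"
    by (intro measure_Un_le) auto
  also have "\<dots> \<le> (1 + c) * pmf \<pi> s"
    using ext[OF True] by (simp add: pmf.rep_eq algebra_simps)
  finally show ?thesis .
next
  case False
  then have "s \<notin> set_pmf (map_pmf (switches_until n) \<pi>)"
    using support switches_until(1) by auto
  then have "pmf (map_pmf (switches_until n) \<pi>) s = 0"
    unfolding set_pmf_iff by simp
  then show ?thesis using c by simp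
qed

text \<open>
  All sequences with the same truncation \<open>s\<close> have the same density at \<open>x\<^sup>n\<close>. Summing over them
  replaces the prior by its image under truncation, which is at most \<open>1 + c\<close> times the prior.
\<close>

lemma nn_integral_other_index_le:
  assumes support: "set_pmf \<pi> \<subseteq> switch_seqs" and c: "0 < c"
    and ext: "\<And>s. s \<in> switch_seqs \<Longrightarrow> measure_pmf.prob \<pi> (switch_extensions s) \<le> c * pmf \<pi> s"
  shows "(\<integral>\<^sup>+s. joint_density (switch_strategy pbar s) n x * indicator {s. switch_index s n \<noteq> k} s \<partial>measure_pmf \<pi>) \<le>
    ennreal (1 + c) * (\<integral>\<^sup>+s. joint_density (switch_strategy pbar s) n x * indicator {s. snd (last s) \<noteq> k} s \<partial>measure_pmf \<pi>)"
proof -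
  define g where "g s = joint_density (switch_strategy pbar s) n x * indicator {s. snd (last s) \<noteq> k} s" for s
  have "(\<integral>\<^sup>+s. joint_density (switch_strategy pbar s) n x * indicator {s. switch_index s n \<noteq> k} s \<partial>measure_pmf \<pi>) =
      (\<integral>\<^sup>+s. g (switches_until n s) \<partial>measure_pmf \<pi>)"
    using support switches_until(3)[of _ n] joint_density_switches_until[of _ pbar n x]
    by (intro nn_integral_cong_AE) (auto simp: AE_measure_pmf_iff g_def indicator_def)
  also have "\<dots> = (\<integral>\<^sup>+s. g s \<partial>measure_pmf (map_pmf (switches_until n) \<pi>))"
    by (simp add: map_pmf_rep_eq nn_integral_distr)
  also have "\<dots> = (\<integral>\<^sup>+s. ennreal (pmf (map_pmf (switches_until n) \<pi>) s) * g s \<partial>count_space UNIV)"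
    by (rule nn_integral_measure_pmf)
  also have "\<dots> \<le> (\<integral>\<^sup>+s. ennreal (1 + c) * (ennreal (pmf \<pi> s) * g s) \<partial>count_space UNIV)"
  proof (intro nn_integral_mono)
    fix s
    have "ennreal (pmf (map_pmf (switches_until n) \<pi>) s) \<le> ennreal (1 + c) * ennreal (pmf \<pi> s)"
      using ennreal_leI[OF pmf_switches_until_le[OF support c ext, of n s]] c
      by (simp only: ennreal_mult pmf_nonneg)
    then show "ennreal (pmf (map_pmf (switches_until n) \<pi>) s) * g s \<le> ennreal (1 + c) * (ennreal (pmf \<pi> s) * g s)"
      unfolding mult.assoc[symmetric] by (rule mult_right_mono) simp
  qed
  also have "\<dots> = ennreal (1 + c) * (\<integral>\<^sup>+s. g s \<partial>measure_pmf \<pi>)"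
    by (simp add: nn_integral_measure_pmf nn_integral_cmult)
  finally show ?thesis unfolding g_def .
qed

section \<open>Convergence of the posterior\<close>

lemma ratio_tendsto_1:
  fixes a b d :: "nat \<Rightarrow> ennreal"
  assumes d: "\<And>n. d n = a n + b n" "\<And>n. 0 < d n" "\<And>n. d n < \<infinity>"
    and b: "\<And>M::nat. \<forall>\<^sub>F n in sequentially. of_nat M * b n \<le> d n"
  shows "(\<lambda>n. a n / d n) \<longlonglongrightarrow> 1"
proof -
  define A B where "A n = enn2real (a n)" and "B n = enn2real (b n)" for n
  have fin: "a n < \<infinity>" "b n < \<infinity>" for n
    using d(1,3)[of n] by (auto simp: less_top[symmetric])
  have A: "a n = ennreal (A n)" "0 \<le> A n" and B: "b n = ennreal (B n)" "0 \<le> B n" for n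
    using fin[of n] by (auto simp: A_def B_def)
  have D: "d n = ennreal (A n + B n)" for n
    using A[of n] B[of n] d(1)[of n] by simp
  have Dpos: "0 < A n + B n" for n
    using d(2)[of n] D[of n] by simp
  have ad: "a n / d n = ennreal (A n / (A n + B n))" for n
    unfolding D using A[of n] Dpos[of n] by (simp add: divide_ennreal)
  have "(\<lambda>n. A n / (A n + B n)) \<longlonglongrightarrow> 1"
  proof (rule LIMSEQ_I)
    fix r :: real assume r: "0 < r"
    from reals_Archimedean3[OF r] obtain M :: nat where M: "1 < M * r" by blast
    have "\<forall>\<^sub>F n in sequentially. norm (A n / (A n + B n) - 1) < r"
      using b[of M]
    proof eventually_elim
      case (elim n)
      then have "ennreal (M * B n) \<le> ennreal (A n + B n)"
        using B[of n] D[of n] by (simp add: ennreal_mult ennreal_of_nat_eq_real_of_nat)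
      then have MB: "M * B n \<le> A n + B n"
        using Dpos[of n] by (subst (asm) ennreal_le_iff) auto
      have "B n < r * (A n + B n)"
      proof (cases "B n = 0")
        case True then show ?thesis using r Dpos[of n] by simp
      next
        case False
        then have "B n < (M * r) * B n" using M B(2)[of n] by simp
        also have "\<dots> = r * (M * B n)" by simp
        also have "\<dots> \<le> r * (A n + B n)" using MB r by (intro mult_left_mono) auto
        finally show ?thesis .
      qed
      moreover have "A n / (A n + B n) - 1 = - (B n / (A n + B n))"
        using Dpos[of n] by (simp add: field_simps)
      ultimately show ?case
        using Dpos[of n] B(2)[of n] by (simp add: pos_divide_less_eq abs_of_nonneg)
    qed
    then show "\<exists>no. \<forall>n\<ge>no. norm (A n / (A n + B n) - 1) < r"
      by (simp add: eventually_sequentially)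
  qed
  from tendsto_ennrealI[OF this] show ?thesis unfolding ad by simp
qed

text \<open>
  The numerators and the denominator of the posterior are instances of this integral, and so is the
  density of the part of the switch distribution carried by \<open>A\<close>.
\<close>

definition switch_mass :: "(nat \<Rightarrow> 'a strategy) \<Rightarrow> (nat \<times> nat) list pmf \<Rightarrow> (nat \<times> nat) list set \<Rightarrow> nat \<Rightarrow> (nat \<Rightarrow> 'a) \<Rightarrow> ennreal" where
  "switch_mass pbar \<pi> A n x = (\<integral>\<^sup>+s. joint_density (switch_strategy pbar s) n x * indicator A s \<partial>measure_pmf \<pi>)"

lemma switch_density_eq_mass:
  assumes "set_pmf \<pi> \<subseteq> switch_seqs"
  shows "switch_density pbar \<pi> n x = switch_mass pbar \<pi> UNIV n x"
  using nn_integral_switch_prior[OF assms, where R="\<lambda>_. True"] by (simp add: switch_density_def switch_mass_def)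

lemma switch_posterior_eq_mass:
  assumes "set_pmf \<pi> \<subseteq> switch_seqs"
  shows "switch_posterior pbar \<pi> k n x =
    switch_mass pbar \<pi> {s. switch_index s n = k} n x / switch_mass pbar \<pi> UNIV n x"
  unfolding switch_posterior_def switch_density_eq_mass[OF assms] nn_integral_switch_prior[OF assms]
  by (simp add: switch_mass_def)

lemma switch_mass_add:
  "switch_mass pbar \<pi> UNIV n x =
    switch_mass pbar \<pi> {s. switch_index s n = k} n x + switch_mass pbar \<pi> {s. switch_index s n \<noteq> k} n x"
  unfolding switch_mass_def
  by (subst nn_integral_add[symmetric]) (auto intro!: nn_integral_cong simp: indicator_def)

lemma switch_mass_ge_singleton:
  assumes "0 < k"
  shows "ennreal (pmf \<pi> [(0, k)]) * joint_density (pbar k) n x \<le> switch_mass pbar \<pi> UNIV n x"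
proof -
  have "ennreal (pmf \<pi> [(0, k)]) * joint_density (pbar k) n x =
      (\<integral>\<^sup>+s. joint_density (pbar k) n x * indicator {[(0, k)]} s \<partial>measure_pmf \<pi>)"
    by (simp add: emeasure_pmf_single mult.commute)
  also have "\<dots> \<le> switch_mass pbar \<pi> UNIV n x"
    unfolding switch_mass_def
    by (intro nn_integral_mono) (auto simp: indicator_def switch_strategy_singleton[OF assms])
  finally show ?thesis .
qed

definition switch_law :: "'a measure \<Rightarrow> (nat \<Rightarrow> 'a strategy) \<Rightarrow> (nat \<times> nat) list pmf \<Rightarrow> (nat \<times> nat) list set \<Rightarrow> (nat \<Rightarrow> 'a) measure" where
  "switch_law N pbar \<pi> A = density (count_space switch_seqs) (\<lambda>s. ennreal (pmf \<pi> s) * indicator A s) \<bind>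
     (\<lambda>s. seq_dist N (switch_strategy pbar s))"

lemma has_densities_switch_law:
  assumes N: "sigma_finite_measure N" and support: "set_pmf \<pi> \<subseteq> switch_seqs"
    and pbar: "\<And>k. 0 < k \<Longrightarrow> pred_strategy N (pbar k)"
  defines "\<mu> \<equiv> \<lambda>A. density (count_space switch_seqs) (\<lambda>s. ennreal (pmf \<pi> s) * indicator A s)"
  shows "has_densities N (switch_law N pbar \<pi> A) (switch_mass pbar \<pi> A)"
    and "(\<lambda>s. seq_dist N (switch_strategy pbar s)) \<in> measurable (\<mu> A) (subprob_algebra (outcome_seqs N))"
proof -
  have sp: "space (\<mu> A) = switch_seqs" by (simp add: \<mu>_def)
  have int: "(\<integral>\<^sup>+s. f s \<partial>\<mu> A) = (\<integral>\<^sup>+s. f s * indicator A s \<partial>measure_pmf \<pi>)" for f :: "_ \<Rightarrow> ennreal"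
  proof -
    have "(\<integral>\<^sup>+s. f s \<partial>\<mu> A) = (\<integral>\<^sup>+s. f s * indicator A s * ennreal (pmf \<pi> s) \<partial>count_space switch_seqs)"
      unfolding \<mu>_def by (subst nn_integral_density) (auto intro!: nn_integral_cong simp: mult_ac)
    then show ?thesis
      using nn_integral_switch_prior[OF support, where f="\<lambda>s. f s * indicator A s" and R="\<lambda>_. True"] by simp
  qed
  have fin: "finite_measure (\<mu> A)"
  proof
    have "emeasure (\<mu> A) (space (\<mu> A)) = (\<integral>\<^sup>+s. 1 \<partial>\<mu> A)" by simp
    also have "\<dots> \<le> (\<integral>\<^sup>+s. 1 \<partial>measure_pmf \<pi>)"
      unfolding int by (intro nn_integral_mono) (simp add: indicator_def)
    also have "\<dots> = 1" by simp
    finally show "emeasure (\<mu> A) (space (\<mu> A)) \<noteq> \<infinity>" by (auto simp: top_unique)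
  qed
  have ne: "space (\<mu> A) \<noteq> {}" using singleton_switch_seqs[of 1] sp by auto
  have p: "pred_strategy N (switch_strategy pbar s)" if "s \<in> space (\<mu> A)" for s
    using that sp by (intro pred_strategy_switch pbar) auto
  have j: "(\<lambda>(s, x). joint_density (switch_strategy pbar s) n x) \<in> borel_measurable (\<mu> A \<Otimes>\<^sub>M histories N n)" for n
  proof -
    have "(\<lambda>(s, x). joint_density (switch_strategy pbar s) n x) \<in> borel_measurable (count_space switch_seqs \<Otimes>\<^sub>M histories N n)"
      using p sp by (intro measurable_pair_measure_countable1) (auto intro: measurable_joint_density)
    moreover have "sets (\<mu> A \<Otimes>\<^sub>M histories N n) = sets (count_space switch_seqs \<Otimes>\<^sub>M histories N n)"
      by (intro sets_pair_measure_cong) (simp_all add: \<mu>_def)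
    ultimately show ?thesis by (subst measurable_cong_sets[OF _ refl])
  qed
  show "(\<lambda>s. seq_dist N (switch_strategy pbar s)) \<in> measurable (\<mu> A) (subprob_algebra (outcome_seqs N))"
    by (intro measurable_prob_algebraD measurable_seq_dist N p j)
  have "has_densities N (\<mu> A \<bind> (\<lambda>s. seq_dist N (switch_strategy pbar s)))
      (\<lambda>n x. \<integral>\<^sup>+s. joint_density (switch_strategy pbar s) n x \<partial>\<mu> A)"
    by (rule has_densities_mixture[OF N fin ne p j])
  then show "has_densities N (switch_law N pbar \<pi> A) (switch_mass pbar \<pi> A)"
    unfolding int switch_mass_def[abs_def] unfolding switch_law_def \<mu>_def .
qed

text \<open>
  A sequence whose last strategy is \<open>k' \<noteq> k\<close> follows \<open>k'\<close> from its last switch time on, so after that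
  time its future is the one of \<open>k'\<close>, which is singular to the future of \<open>k\<close>.
\<close>

lemma switch_law_singular:
  assumes N: "sigma_finite_measure N" and support: "set_pmf \<pi> \<subseteq> switch_seqs"
    and pbar: "\<And>k. 0 < k \<Longrightarrow> pred_strategy N (pbar k)" and k: "0 < k"
    and singular: "\<And>k' n x. 0 < k' \<Longrightarrow> k \<noteq> k' \<Longrightarrow> x \<in> space (histories N n) \<Longrightarrow>
                   mutually_singular (future_dist N (pbar k) n x) (future_dist N (pbar k') n x)"
  shows "mutually_singular (seq_dist N (pbar k)) (switch_law N pbar \<pi> {s. snd (last s) \<noteq> k})"
  unfolding switch_law_def
proof (rule mutually_singular_bind[OF _ _ has_densities_switch_law(2)[where pbar=pbar, OF N support pbar]])
  let ?A = "{s \<in> switch_seqs. snd (last s) \<noteq> k}"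
  let ?\<mu> = "density (count_space switch_seqs) (\<lambda>s. ennreal (pmf \<pi> s) * indicator {s. snd (last s) \<noteq> k} s)"
  show "countable ?A" by simp
  show "space ?\<mu> \<noteq> {}" using singleton_switch_seqs[of 1] by auto
  show "sets (seq_dist N (pbar k)) = sets (outcome_seqs N)" using N pbar[OF k] by simp
  show "AE s in ?\<mu>. s \<in> ?A"
    by (subst AE_density) (auto simp: AE_count_space indicator_def split: if_splits)
  fix s assume s: "s \<in> ?A"
  then have s_seq: "s \<in> switch_seqs" by simp
  have pos: "0 < snd (last s)"
    using switch_index_pos[OF s_seq, of "fst (last s)"] switch_index_after_last[OF s_seq] by simp
  show "mutually_singular (seq_dist N (pbar k)) (seq_dist N (switch_strategy pbar s))"
  proof (rule singular_futures_imp_singular[OF N pbar[OF k] pred_strategy_switch[OF pbar s_seq]])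
    fix x assume x: "x \<in> space (histories N (fst (last s)))"
    show "mutually_singular (future_dist N (pbar k) (fst (last s)) x) (future_dist N (switch_strategy pbar s) (fst (last s)) x)"
      using singular[OF pos _ x] s unfolding future_dist_def future_switch_after_last[OF s_seq order_refl] by simp
  qed
qed

text \<open>
  The posterior mass of \<open>K\<^sub>n\<^sub>+\<^sub>1 \<noteq> k\<close> has a numerator of at most \<open>1 + c\<close> times the mass \<open>r\<close> of the
  sequences that do not end in \<open>k\<close>, and a denominator of at least \<open>\<pi>((0,k))\<close> times the density of
  strategy \<open>k\<close>. By singularity \<open>r\<close> is negligible against that density.
\<close>

lemma switch_posterior_tendsto_bayes:
  assumes N: "sigma_finite_measure N" and support: "set_pmf \<pi> \<subseteq> switch_seqs"
    and pbar: "\<And>k. 0 < k \<Longrightarrow> pred_strategy N (pbar k)" and k: "0 < k"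
    and pos: "0 < pmf \<pi> [(0, k)]"
    and c: "0 < c"
    and ext: "\<And>s. s \<in> switch_seqs \<Longrightarrow> measure_pmf.prob \<pi> (switch_extensions s) \<le> c * pmf \<pi> s"
    and singular: "\<And>k' n x. 0 < k' \<Longrightarrow> k \<noteq> k' \<Longrightarrow> x \<in> space (histories N n) \<Longrightarrow>
                   mutually_singular (future_dist N (pbar k) n x) (future_dist N (pbar k') n x)"
  shows "AE \<omega> in seq_dist N (pbar k). (\<lambda>n. switch_posterior pbar \<pi> k n (initial n \<omega>)) \<longlonglongrightarrow> 1"
proof -
  let ?P = "seq_dist N (pbar k)" and ?p = "joint_density (pbar k)"
  let ?r = "switch_mass pbar \<pi> {s. snd (last s) \<noteq> k}" and ?d = "switch_mass pbar \<pi> UNIV"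
  note P = has_densities_seq_dist(2)[OF N pbar[OF k]]
  note law = has_densities_switch_law(1)[where pbar=pbar, OF N support pbar]
  have "AE \<omega> in ?P. ratio_vanishes ?r ?p \<omega>"
    by (rule singular_imp_ratio_vanishes[OF P law
          switch_law_singular[where pbar=pbar and k=k, OF N support pbar k singular]])
  moreover have "AE \<omega> in ?P. \<forall>n. 0 < ?p n (initial n \<omega>)"
    using has_densities_AE_initial[OF P has_densities_AE_pos[OF P]] by (subst AE_all_countable) blast
  moreover have "AE \<omega> in ?P. \<forall>n. ?d n (initial n \<omega>) < \<infinity>"
  proof (subst AE_all_countable, rule)
    fix n
    have "AE x in density (histories N n) (?p n). ?d n x < \<infinity>"
      using has_densities_AE_finite[OF law[where A=UNIV], where n=n]
      by (subst AE_density) (auto simp: has_densitiesD(4)[OF P])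
    then show "AE \<omega> in ?P. ?d n (initial n \<omega>) < \<infinity>"
      by (rule has_densities_AE_initial[OF P])
  qed
  ultimately show ?thesis
  proof eventually_elim
    case (elim \<omega>)
    define \<rho> where "\<rho> = pmf \<pi> [(0, k)]"
    have \<rho>: "0 < \<rho>" using pos by (simp add: \<rho>_def)
    have d: "ennreal \<rho> * ?p n x \<le> ?d n x" for n x
      unfolding \<rho>_def by (rule switch_mass_ge_singleton[OF k])
    show ?case
      unfolding switch_posterior_eq_mass[OF support]
    proof (rule ratio_tendsto_1[OF switch_mass_add])
      show "?d n (initial n \<omega>) < \<infinity>" for n using elim by blast
      show "0 < ?d n (initial n \<omega>)" for n
      proof -
        have "0 < ennreal \<rho> * ?p n (initial n \<omega>)"
          using elim(2) \<rho> by (simp add: ennreal_zero_less_mult_iff del: restrict_apply)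
        then show ?thesis using d[of n "initial n \<omega>"] by (rule less_le_trans)
      qed
      fix M :: nat
      \<comment> \<open>\<open>M'\<close> absorbs the constants \<open>1 + c\<close> and \<open>1 / \<rho>\<close>.\<close>
      from reals_Archimedean3[OF \<rho>] obtain M' :: nat where M': "real M * (1 + c) < real M' * \<rho>" by blast
      have M'': "of_nat M * ennreal (1 + c) \<le> ennreal \<rho> * of_nat M'"
      proof -
        have "ennreal (real M * (1 + c)) \<le> ennreal (\<rho> * real M')"
          using M' by (intro ennreal_leI) (simp add: mult.commute)
        then show ?thesis
          using c \<rho> by (simp only: ennreal_of_nat_eq_real_of_nat ennreal_mult[symmetric] of_nat_0_le_iff)
      qed
      show "\<forall>\<^sub>F n in sequentially. of_nat M * switch_mass pbar \<pi> {s. switch_index s n \<noteq> k} n (initial n \<omega>) \<le> ?d n (initial n \<omega>)"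
        using elim(1)[unfolded ratio_vanishes_def, THEN spec, of M']
      proof eventually_elim
        case (elim n)
        let ?x = "initial n \<omega>"
        have "of_nat M * switch_mass pbar \<pi> {s. switch_index s n \<noteq> k} n ?x \<le> of_nat M * (ennreal (1 + c) * ?r n ?x)"
          unfolding switch_mass_def by (intro mult_left_mono nn_integral_other_index_le[OF support c ext]) auto
        also have "\<dots> = (of_nat M * ennreal (1 + c)) * ?r n ?x" by (simp only: mult.assoc)
        also have "\<dots> \<le> (ennreal \<rho> * of_nat M') * ?r n ?x" using M'' by (rule mult_right_mono) simp
        also have "\<dots> = ennreal \<rho> * (of_nat M' * ?r n ?x)" by (simp only: mult.assoc)
        also have "\<dots> \<le> ennreal \<rho> * ?p n ?x" using elim by (rule mult_left_mono) simp
        also have "\<dots> \<le> ?d n ?x" by (rule d)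
        finally show ?case .
      qed
    qed
  qed
qed

theorem theorem1:
  fixes X :: "'a::euclidean_space set"
    and N :: "'a measure"
    and d :: "nat \<Rightarrow> nat"
    and \<Theta> :: "nat \<Rightarrow> (nat \<Rightarrow> real) set"
    and w :: "nat \<Rightarrow> (nat \<Rightarrow> real) \<Rightarrow> ennreal"
    and p :: "nat \<Rightarrow> (nat \<Rightarrow> real) \<Rightarrow> 'a strategy"
    and pbar :: "nat \<Rightarrow> 'a strategy"
    and \<pi> :: "(nat \<times> nat) list pmf"
    and c :: real
  assumes base: "base_measure X N"
    and model: "\<And>k. 0 < k \<Longrightarrow> parametric_model N (d k) (\<Theta> k) (p k)"
    and prior: "\<And>k. 0 < k \<Longrightarrow> prior_density (d k) (\<Theta> k) (w k)"
    and bayes: "\<And>k. 0 < k \<Longrightarrow> bayes_strategy N (d k) (\<Theta> k) (w k) (p k) (pbar k)"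
    and pi_support: "set_pmf \<pi> \<subseteq> switch_seqs"
    and pi_pos: "\<And>s. s \<in> switch_seqs \<Longrightarrow> length s = 1 \<Longrightarrow> 0 < pmf \<pi> s"
    and c_pos: "0 < c"
    and pi_ext: "\<And>s. s \<in> switch_seqs \<Longrightarrow>
                   measure_pmf.prob \<pi> (switch_extensions s) \<le> c * pmf \<pi> s"
    and singular: "\<And>k k' n x. 0 < k \<Longrightarrow> 0 < k' \<Longrightarrow> k \<noteq> k' \<Longrightarrow>
                   x \<in> space (\<Pi>\<^sub>M i\<in>{0..<n}. N) \<Longrightarrow>
                   mutually_singular (future_dist N (pbar k) n x) (future_dist N (pbar k') n x)"
  shows "\<forall>k>0. AE \<theta> in prior_measure (d k) (\<Theta> k) (w k).
           AE x in seq_dist N (p k \<theta>).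
             (\<lambda>n. switch_posterior pbar \<pi> k n (restrict x {0..<n})) \<longlonglongrightarrow> 1"
proof (intro allI impI)
  fix k :: nat assume k: "0 < k"
  have N: "sigma_finite_measure N" by (rule base_measure_sigma_finite[OF base])
  have pbar: "pred_strategy N (pbar k)" if "0 < k" for k
    using bayes[OF that] by (simp add: bayes_strategy_def)
  have "AE \<omega> in seq_dist N (pbar k). (\<lambda>n. switch_posterior pbar \<pi> k n (initial n \<omega>)) \<longlonglongrightarrow> 1"
    by (intro switch_posterior_tendsto_bayes[where pbar=pbar and k=k, OF N pi_support pbar k _ c_pos pi_ext singular[OF k]]
        pi_pos singleton_switch_seqs k) auto
  then show "AE \<theta> in prior_measure (d k) (\<Theta> k) (w k). AE x in seq_dist N (p k \<theta>).
      (\<lambda>n. switch_posterior pbar \<pi> k n (initial n x)) \<longlonglongrightarrow> 1"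
    unfolding bayes_strategy_mixture(2)[OF N model[OF k] prior[OF k] bayes[OF k]]
    by (rule AE_bind_imp_AE[OF bayes_strategy_mixture(1)[OF N model[OF k] prior[OF k] bayes[OF k]]])
qed

end
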